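(* Let $P=P_a$ be the hNRMI with Lévy intensity $\rho(ds)\,aH(dx)$ (as in the context) and assume $\tilde{\tau}_1=\int_1^\infty s\,\rho(ds)<\infty$. As $a\to\infty$: (i) (Strong law of large numbers) $P\to H$ almost surely in $\mathbb{M}_{\mathbb{X}}$ with respect to the metric $d$, i.e. $d(P,H)\to0$ almost surely. (ii) (Glivenko–Cantelli) If $(\mathbb{X},\mathcal{X})=(\mathbb{R},\mathcal{B}(\mathbb{R}))$, then $\sup_{x\in\mathbb{R}}|P((-\infty,x])-H((-\infty,x])|\to0$ almost surely.
   Context: $(\mathbb{X},\mathcal{X})$ is a complete separable metric space (metric $\eta$) with its Borel $\sigma$-algebra. $\rho$ is a measure on $(0,\infty)$ with $\int_0^\infty\min(s,1)\rho(ds)<\infty$ and $\rho((0,\infty))=\infty$; $H$ is a non-atomic probability measure on $\mathbb{X}$; $a>0$. Realize all $a$ on one probability space: $N$ is a Poisson random measure on $[0,\infty)\times(0,\infty)\times\mathbb{X}$ with mean measure $d\zeta\,\rho(ds)H(dx)$, $\tilde{\mu}_a(A)=\int_0^a\int_0^\infty\int_A s\,N(d\zeta,ds,dx)$ (a completely random measure with Lévy intensity $\rho(ds)\,aH(dx)$), and $P(\cdot)=\tilde{\mu}_a(\cdot)/\tilde{\mu}_a(\mathbb{X})$. $\mathbb{M}_{\mathbb{X}}$ is the space of probability measures on $\mathbb{X}$ with the metric $d(\xi_1,\xi_2)=\sum_{i=1}^\infty 2^{-i}\big(|\int f_i\,d\xi_1-\int f_i\,d\xi_2|\wedge1\big)$,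 where $\{f_i\}_{i\ge1}$ is a countable dense subset of the space $C_b(\mathbb{X},\eta)$ of bounded continuous functions. *)

theory Defs
  imports "HOL-Probability.Probability"
begin

definition poisson_random_measure ::
  "'w measure \<Rightarrow> ('w \<Rightarrow> 'b measure) \<Rightarrow> 'b measure \<Rightarrow> bool" where
  "poisson_random_measure M N nu \<longleftrightarrow>
     prob_space M \<and>
     (\<forall>w\<in>space M. sets (N w) = sets nu) \<and>
     (\<forall>B\<in>sets nu.
        (\<lambda>w. emeasure (N w) B) \<in> borel_measurable M \<and>
        (emeasure nu B < \<infinity> \<longrightarrow>
           (\<forall>k::nat. measure M {w\<in>space M. emeasure (N w) B = of_nat k}
              = exp (- enn2real (emeasure nu B)) * enn2real (emeasure nu B) ^ k / fact k)) \<and>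
        (emeasure nu B = \<infinity> \<longrightarrow> (AE w in M. emeasure (N w) B = \<infinity>))) \<and>
     (\<forall>(n::nat) (B::nat \<Rightarrow> 'b set).
        (\<forall>i<n. B i \<in> sets nu) \<and> disjoint_family_on B {..<n} \<longrightarrow>
        prob_space.indep_vars M (\<lambda>_. borel) (\<lambda>i w. emeasure (N w) (B i)) {..<n})"

definition mean_measure :: "real measure \<Rightarrow> 'a measure \<Rightarrow> (real \<times> real \<times> 'a) measure" where
  "mean_measure rho H =
     density (lborel \<Otimes>\<^sub>M (rho \<Otimes>\<^sub>M H))
       (indicator ({0..} \<times> {0<..} \<times> UNIV))"

definition crm :: "('w \<Rightarrow> (real \<times> real \<times> 'a::topological_space) measure) \<Rightarrow> real \<Rightarrow> 'w \<Rightarrow> 'a measure" where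
  "crm N a w =
     distr (density (N w) (\<lambda>z. ennreal (fst (snd z)) * indicator ({0..a} \<times> UNIV) z))
       (borel :: 'a measure) (\<lambda>z. snd (snd z))"

definition hnrmi :: "('w \<Rightarrow> (real \<times> real \<times> 'a::topological_space) measure) \<Rightarrow> real \<Rightarrow> 'w \<Rightarrow> 'a measure" where
  "hnrmi N a w = density (crm N a w) (\<lambda>_. inverse (emeasure (crm N a w) (space (crm N a w))))"

text \<open>The metric d(xi1,xi2) = sum_{i>=1} 2^-i (|int f_i dxi1 - int f_i dxi2| min 1),
  with the sequence (f_i) indexed from 0 here (f 0 plays the role of f_1).\<close>
definition dM :: "(nat \<Rightarrow> 'a \<Rightarrow> real) \<Rightarrow> 'a measure \<Rightarrow> 'a measure \<Rightarrow> real" where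
  "dM f xi1 xi2 =
     (\<Sum>i. (1/2) ^ Suc i * min \<bar>(\<integral>x. f i x \<partial>xi1) - (\<integral>x. f i x \<partial>xi2)\<bar> 1)"

end

theory Submission
  imports Defs
begin

text \<open>
  The jumps and locations falling into the time strip \<open>[0, a]\<close> form a Poisson random measure with
  intensity \<open>a \<cdot> (\<rho> \<otimes> H)\<close>, which grows with \<open>a\<close>. For any such family and any integrable
  \<open>F\<close>, Etemadi's method gives the strong law: along \<open>a = b ^ k\<close> truncate \<open>F\<close> at \<open>b ^ k\<close>; points
  with \<open>F > b ^ k\<close> occur for finitely many \<open>k\<close> only, and by Campbell's second-moment formula the
  variances of the truncated averages are summable, both because \<open>F\<close> has a finite first moment.
  Monotonicity in \<open>a\<close> fills the gaps as \<open>b\<close> decreases to 1. Applied to \<open>F (s, x) = s * f x\<close> and to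
  \<open>F (s, x) = s\<close>, it yields \<open>\<integral> f dP \<rightarrow> \<integral> f dH\<close>; countably many \<open>f\<close> at a time suffice, for the
  metric by dominated convergence and for half-lines by bracketing between quantiles of \<open>H\<close>.
\<close>

section \<open>Moments of the Poisson distribution\<close>

lemma suminf_ennreal_sums:
  assumes "f sums l" and "\<And>k. 0 \<le> f k"
  shows "(\<Sum>k. ennreal (f k)) = ennreal l"
  using assms by (metis suminf_ennreal2 sums_iff)

lemma suminf_ennreal_le:
  assumes "\<And>k. 0 \<le> f k" and "\<And>n. (\<Sum>k<n. f k) \<le> C"
  shows "(\<Sum>k. ennreal (f k)) \<le> ennreal C"
  using assms by (intro suminf_le_const) (auto simp: ennreal_leI)

lemma poisson_weights_sums: "(\<lambda>k. exp (- l) * l ^ k / fact k) sums (1 :: real)"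
proof -
  have "(\<lambda>k. exp (- l) * (l ^ k /\<^sub>R fact k)) sums (exp (- l) * exp l)"
    by (intro sums_mult exp_converges)
  then show ?thesis
    by (simp add: exp_minus field_simps)
qed

lemma poisson_first_moment_sums:
  fixes l :: real
  shows "(\<lambda>k. real k * (exp (- l) * l ^ k / fact k)) sums l"
proof -
  have "(\<lambda>k. l * (exp (- l) * l ^ k / fact k)) sums (l * 1)"
    by (intro sums_mult poisson_weights_sums)
  moreover have "l * (exp (- l) * l ^ k / fact k)
      = real (Suc k) * (exp (- l) * l ^ Suc k / fact (Suc k))" for k
    by (simp add: field_simps del: of_nat_Suc)
  ultimately have "(\<lambda>k. real (Suc k) * (exp (- l) * l ^ Suc k / fact (Suc k))) sums l"
    by (simp only: mult_1_right)
  then show ?thesis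
    by (subst (asm) sums_Suc_iff) simp
qed

lemma poisson_second_moment_sums:
  fixes l :: real
  shows "(\<lambda>k. (real k)\<^sup>2 * (exp (- l) * l ^ k / fact k)) sums (l\<^sup>2 + l)"
proof -
  have "(\<lambda>k. l * (real k * (exp (- l) * l ^ k / fact k) + exp (- l) * l ^ k / fact k))
      sums (l * (l + 1))"
    by (intro sums_mult sums_add poisson_first_moment_sums poisson_weights_sums)
  moreover have "l * (real k * (exp (- l) * l ^ k / fact k) + exp (- l) * l ^ k / fact k)
      = (real (Suc k))\<^sup>2 * (exp (- l) * l ^ Suc k / fact (Suc k))" for k
  proof -
    have "(real (Suc k))\<^sup>2 * (exp (- l) * l ^ Suc k / fact (Suc k))
        = real (Suc k) * (exp (- l) * l ^ Suc k / fact k)"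
      by (simp add: power2_eq_square del: of_nat_Suc)
    then show ?thesis
      by (simp add: field_simps)
  qed
  ultimately have "(\<lambda>k. (real (Suc k))\<^sup>2 * (exp (- l) * l ^ Suc k / fact (Suc k))) sums (l\<^sup>2 + l)"
    by (simp add: power2_eq_square distrib_left)
  then show ?thesis
    by (subst (asm) sums_Suc_iff) simp
qed

section \<open>Poisson random measures and Campbell's formulas\<close>

lemma (in prob_space) nn_integral_variance:
  fixes X :: "'a \<Rightarrow> real"
  assumes [measurable]: "X \<in> borel_measurable M" and nonneg: "\<And>w. 0 \<le> X w"
    and mean: "(\<integral>\<^sup>+w. ennreal (X w) \<partial>M) = ennreal e" "0 \<le> e"
    and second_moment: "(\<integral>\<^sup>+w. ennreal ((X w)\<^sup>2) \<partial>M) = ennreal (e\<^sup>2 + v)" "0 \<le> v"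
  shows "(\<integral>\<^sup>+w. ennreal ((X w - e)\<^sup>2) \<partial>M) = ennreal v"
proof -
  have integrable: "integrable M X" "integrable M (\<lambda>w. (X w)\<^sup>2)"
    using nonneg mean second_moment by (auto intro!: integrableI_bounded)
  have "expectation X = e" "expectation (\<lambda>w. (X w)\<^sup>2) = e\<^sup>2 + v"
    using nonneg mean second_moment by (simp_all add: integral_eq_nn_integral del: ennreal_plus)
  then have "expectation (\<lambda>w. (X w - e)\<^sup>2) = v"
    using variance_eq[OF integrable] by simp
  moreover have "integrable M (\<lambda>w. (X w - e)\<^sup>2)"
    using integrable by (auto simp: power2_diff)
  ultimately show ?thesis
    by (subst nn_integral_eq_integral) auto
qed

lemma (in prob_space) indep_vars_cong_on_space:
  assumes "\<And>i w. i \<in> I \<Longrightarrow> w \<in> space M \<Longrightarrow> X i w = Y i w"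
  shows "indep_vars M' X I \<longleftrightarrow> indep_vars M' Y I"
proof -
  have "X i -` A \<inter> space M = Y i -` A \<inter> space M" if "i \<in> I" for i A
    using assms that by auto
  then show ?thesis
    using assms unfolding indep_vars_def2
    by (intro conj_cong ball_cong indep_sets_cong measurable_cong) auto
qed

lemma emeasure_distr_restricted:
  assumes "S \<in> sets m" "f \<in> measurable m L" "B \<in> sets L"
  shows "emeasure (distr (density m (indicator S)) L f) B = emeasure m (S \<inter> (f -` B \<inter> space m))"
  using assms by (simp add: emeasure_distr emeasure_restricted measurable_sets)

locale random_measure =
  fixes M :: "'w measure" and N :: "'w \<Rightarrow> 'b measure" and S :: "'b measure"
  assumes sets_N: "w \<in> space M \<Longrightarrow> sets (N w) = sets S"
    and measurable_emeasure_N [measurable]: "A \<in> sets S \<Longrightarrow> (\<lambda>w. emeasure (N w) A) \<in> borel_measurable M"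
begin

lemma space_N: "w \<in> space M \<Longrightarrow> space (N w) = space S"
  by (rule sets_eq_imp_space_eq[OF sets_N])

lemma measurable_N: "w \<in> space M \<Longrightarrow> g \<in> measurable S L \<Longrightarrow> g \<in> measurable (N w) L"
  using measurable_cong_sets[OF sets_N refl] by blast

lemma nn_integral_N_SUP:
  assumes "w \<in> space M" "\<And>i. U i \<in> borel_measurable S" "incseq U"
  shows "(\<integral>\<^sup>+z. (SUP i. U i) z \<partial>N w) = (SUP i. \<integral>\<^sup>+z. U i z \<partial>N w)"
  unfolding SUP_apply using assms
  by (intro nn_integral_monotone_convergence_SUP) (auto intro: measurable_N)

lemma measurable_nn_integral_N [measurable]:
  assumes "g \<in> borel_measurable S"
  shows "(\<lambda>w. \<integral>\<^sup>+z. g z \<partial>N w) \<in> borel_measurable M"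
  using assms
proof (induction rule: borel_measurable_induct)
  case (cong f g)
  then have "(\<integral>\<^sup>+z. f z \<partial>N w) = (\<integral>\<^sup>+z. g z \<partial>N w)" if "w \<in> space M" for w
    using that by (intro nn_integral_cong) (simp add: space_N)
  with cong show ?case
    by (simp cong: measurable_cong)
next
  case (set A)
  then show ?case
    by (simp add: sets_N cong: measurable_cong)
next
  case (mult u c)
  then show ?case
    by (simp add: nn_integral_cmult measurable_N cong: measurable_cong)
next
  case (add u v)
  then show ?case
    by (simp add: nn_integral_add measurable_N cong: measurable_cong)
next
  case (seq U)
  then show ?case
    by (simp only: nn_integral_N_SUP cong: measurable_cong) simp
qed

lemma nn_integral_mult_nn_integral_N_SUP:
  assumes [measurable]: "Z \<in> borel_measurable M" "\<And>i. U i \<in> borel_measurable S" and "incseq U"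
  shows "(\<integral>\<^sup>+w. Z w * (\<integral>\<^sup>+z. (SUP i. U i) z \<partial>N w) \<partial>M) = (SUP i. \<integral>\<^sup>+w. Z w * (\<integral>\<^sup>+z. U i z \<partial>N w) \<partial>M)"
proof -
  have "(\<integral>\<^sup>+w. Z w * (\<integral>\<^sup>+z. (SUP i. U i) z \<partial>N w) \<partial>M)
      = (\<integral>\<^sup>+w. (SUP i. Z w * (\<integral>\<^sup>+z. U i z \<partial>N w)) \<partial>M)"
    using assms by (intro nn_integral_cong) (simp only: nn_integral_N_SUP SUP_mult_left_ennreal)
  also have "\<dots> = (SUP i. \<integral>\<^sup>+w. Z w * (\<integral>\<^sup>+z. U i z \<partial>N w) \<partial>M)"
    using \<open>incseq U\<close> by (intro nn_integral_monotone_convergence_SUP)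
      (auto simp: incseq_def le_fun_def intro!: mult_left_mono nn_integral_mono)
  finally show ?thesis .
qed

lemma nn_integral_Campbell_weighted:
  assumes g_measurable: "g \<in> borel_measurable S"
    and Z_measurable [measurable]: "Z \<in> borel_measurable M"
    and sets_mu [measurable_cong, simp]: "sets mu = sets S"
    and intensity: "\<And>A. A \<in> sets S \<Longrightarrow> (\<integral>\<^sup>+w. Z w * emeasure (N w) A \<partial>M) = emeasure mu A"
  shows "(\<integral>\<^sup>+w. Z w * (\<integral>\<^sup>+z. g z \<partial>N w) \<partial>M) = (\<integral>\<^sup>+z. g z \<partial>mu)"
  using g_measurable
proof (induction rule: borel_measurable_induct)
  case (cong f g)
  have "(\<integral>\<^sup>+z. f z \<partial>N w) = (\<integral>\<^sup>+z. g z \<partial>N w)" if "w \<in> space M" for w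
    using cong(3) that by (intro nn_integral_cong) (simp add: space_N)
  moreover have "(\<integral>\<^sup>+z. f z \<partial>mu) = (\<integral>\<^sup>+z. g z \<partial>mu)"
    using cong(3) sets_eq_imp_space_eq[OF sets_mu] by (intro nn_integral_cong) simp
  ultimately show ?case
    using cong(4) by (simp cong: nn_integral_cong)
next
  case (set A)
  then show ?case
    by (simp add: sets_N intensity cong: nn_integral_cong)
next
  case (mult u c)
  then have "(\<integral>\<^sup>+w. Z w * (\<integral>\<^sup>+z. c * u z \<partial>N w) \<partial>M) = (\<integral>\<^sup>+w. c * (Z w * (\<integral>\<^sup>+z. u z \<partial>N w)) \<partial>M)"
    by (intro nn_integral_cong) (simp add: nn_integral_cmult measurable_N mult.left_commute)
  with mult show ?case
    by (simp add: nn_integral_cmult)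
next
  case (add u v)
  then have "(\<integral>\<^sup>+w. Z w * (\<integral>\<^sup>+z. v z + u z \<partial>N w) \<partial>M)
      = (\<integral>\<^sup>+w. Z w * (\<integral>\<^sup>+z. v z \<partial>N w) + Z w * (\<integral>\<^sup>+z. u z \<partial>N w) \<partial>M)"
    by (intro nn_integral_cong) (simp add: nn_integral_add measurable_N distrib_left)
  with add show ?case
    by (simp add: nn_integral_add)
next
  case (seq U)
  then have "(\<integral>\<^sup>+w. Z w * (\<integral>\<^sup>+z. (SUP i. U i) z \<partial>N w) \<partial>M) = (SUP i. \<integral>\<^sup>+z. U i z \<partial>mu)"
    by (simp only: nn_integral_mult_nn_integral_N_SUP[OF Z_measurable])
  also have "\<dots> = (\<integral>\<^sup>+z. (SUP i. U i) z \<partial>mu)"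
    using seq unfolding SUP_apply by (intro nn_integral_monotone_convergence_SUP[symmetric]) auto
  finally show ?case .
qed

end

locale prm =
  fixes M :: "'w measure" and N :: "'w \<Rightarrow> 'b measure" and nu :: "'b measure"
  assumes prm: "poisson_random_measure M N nu"
begin

sublocale prob_space M
  using prm by (simp add: poisson_random_measure_def)

sublocale random_measure M N nu
  using prm by unfold_locales (auto simp: poisson_random_measure_def)

lemma prob_emeasure_N_eq:
  assumes "B \<in> sets nu" "emeasure nu B < \<infinity>"
  shows "prob {w\<in>space M. emeasure (N w) B = of_nat k}
    = exp (- measure nu B) * measure nu B ^ k / fact k"
  using prm assms unfolding poisson_random_measure_def measure_def by blast

lemma AE_emeasure_N_top:
  assumes "B \<in> sets nu" "emeasure nu B = \<infinity>"
  shows "AE w in M. emeasure (N w) B = \<infinity>"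
  using prm assms unfolding poisson_random_measure_def by blast

lemma indep_vars_emeasure_N:
  fixes n :: nat
  assumes "\<And>i. i < n \<Longrightarrow> B i \<in> sets nu" "disjoint_family_on B {..<n}"
  shows "indep_vars (\<lambda>_. borel) (\<lambda>i w. emeasure (N w) (B i)) {..<n}"
  using prm assms unfolding poisson_random_measure_def by blast

lemma AE_emeasure_N_nat:
  assumes B_sets [measurable]: "B \<in> sets nu" and B_finite: "emeasure nu B < \<infinity>"
  shows "AE w in M. \<exists>k::nat. emeasure (N w) B = of_nat k"
proof -
  let ?E = "\<lambda>k::nat. {w\<in>space M. emeasure (N w) B = of_nat k}"
  have "(\<lambda>k. prob (?E k)) sums prob (\<Union>k. ?E k)"
    by (intro finite_measure_UNION) (auto simp: disjoint_family_on_def)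
  moreover have "(\<lambda>k. prob (?E k)) sums 1"
    unfolding prob_emeasure_N_eq[OF B_sets B_finite] by (rule poisson_weights_sums)
  ultimately have "prob (\<Union>k. ?E k) = 1"
    using sums_unique2 by blast
  then have "AE w in M. w \<in> (\<Union>k. ?E k)"
    by (subst prob_eq_1[symmetric]) auto
  then show ?thesis
    by eventually_elim auto
qed

lemma nn_integral_emeasure_N_comp:
  fixes \<phi> :: "ennreal \<Rightarrow> ennreal"
  assumes B_sets [measurable]: "B \<in> sets nu" and B_finite: "emeasure nu B < \<infinity>"
  defines "l \<equiv> measure nu B"
  shows "(\<integral>\<^sup>+w. \<phi> (emeasure (N w) B) \<partial>M)
    = (\<Sum>k. \<phi> (of_nat k) * ennreal (exp (- l) * l ^ k / fact k))"
proof -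
  let ?E = "\<lambda>k::nat. {w\<in>space M. emeasure (N w) B = of_nat k}"
  have "(\<integral>\<^sup>+w. \<phi> (emeasure (N w) B) \<partial>M) = (\<integral>\<^sup>+w. (\<Sum>k. \<phi> (of_nat k) * indicator (?E k) w) \<partial>M)"
  proof (rule nn_integral_cong_AE,
      use AE_emeasure_N_nat[OF B_sets B_finite] AE_space in eventually_elim)
    case (elim w)
    then obtain j :: nat where count_eq: "emeasure (N w) B = of_nat j"
      by auto
    then have "(\<Sum>k. \<phi> (of_nat k) * indicator (?E k) w) = (\<Sum>k\<in>{j}. \<phi> (of_nat k) * indicator (?E k) w)"
      by (intro suminf_finite) (auto split: split_indicator)
    with count_eq elim show ?case
      by simp
  qed
  also have "\<dots> = (\<Sum>k. \<integral>\<^sup>+w. \<phi> (of_nat k) * indicator (?E k) w \<partial>M)"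
    by (intro nn_integral_suminf) auto
  also have "\<dots> = (\<Sum>k. \<phi> (of_nat k) * ennreal (exp (- l) * l ^ k / fact k))"
    using prob_emeasure_N_eq[OF B_sets B_finite]
    by (simp add: nn_integral_cmult emeasure_eq_measure l_def)
  finally show ?thesis .
qed

lemma nn_integral_emeasure_N:
  assumes B_sets: "B \<in> sets nu"
  shows "(\<integral>\<^sup>+w. emeasure (N w) B \<partial>M) = emeasure nu B"
proof (cases "emeasure nu B = \<infinity>")
  case True
  then show ?thesis
    using nn_integral_cong_AE[OF AE_emeasure_N_top[OF B_sets True]] by (simp add: emeasure_space_1)
next
  case False
  define l where "l = measure nu B"
  have intensity_eq: "emeasure nu B = ennreal l"
    using False by (simp add: l_def emeasure_eq_ennreal_measure)
  then have "(\<integral>\<^sup>+w. emeasure (N w) B \<partial>M) = (\<Sum>k. of_nat k * ennreal (exp (- l) * l ^ k / fact k))"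
    using nn_integral_emeasure_N_comp[OF B_sets, of "\<lambda>x. x"] by (simp add: l_def)
  also have "\<dots> = (\<Sum>k. ennreal (real k * (exp (- l) * l ^ k / fact k)))"
    by (simp only: ennreal_mult'[OF of_nat_0_le_iff] ennreal_of_nat_eq_real_of_nat)
  also have "\<dots> = ennreal l"
    by (intro suminf_ennreal_sums poisson_first_moment_sums) (simp add: l_def)
  finally show ?thesis
    by (simp add: intensity_eq)
qed

lemma nn_integral_emeasure_N_square:
  assumes B_sets: "B \<in> sets nu"
  shows "(\<integral>\<^sup>+w. emeasure (N w) B * emeasure (N w) B \<partial>M)
    = emeasure nu B * emeasure nu B + emeasure nu B"
proof (cases "emeasure nu B = \<infinity>")
  case True
  have "(\<integral>\<^sup>+w. emeasure (N w) B * emeasure (N w) B \<partial>M) = (\<integral>\<^sup>+w. \<infinity> \<partial>M)"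
    using AE_emeasure_N_top[OF B_sets True] by (intro nn_integral_cong_AE, eventually_elim) simp
  then show ?thesis
    using True by (simp add: emeasure_space_1)
next
  case False
  define l where "l = measure nu B"
  have intensity_eq: "emeasure nu B = ennreal l" and l_nonneg: "0 \<le> l"
    using False by (simp_all add: l_def emeasure_eq_ennreal_measure)
  have "(\<integral>\<^sup>+w. emeasure (N w) B * emeasure (N w) B \<partial>M)
      = (\<Sum>k. (of_nat k * of_nat k) * ennreal (exp (- l) * l ^ k / fact k))"
    using nn_integral_emeasure_N_comp[OF B_sets, of "\<lambda>x. x * x"] intensity_eq by (simp add: l_def)
  also have "\<dots> = (\<Sum>k. ennreal ((real k)\<^sup>2 * (exp (- l) * l ^ k / fact k)))"
    by (simp only: ennreal_mult' of_nat_0_le_iff power2_eq_square zero_le_square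
        ennreal_of_nat_eq_real_of_nat)
  also have "\<dots> = ennreal (l\<^sup>2 + l)"
    using l_nonneg by (intro suminf_ennreal_sums poisson_second_moment_sums) simp
  finally show ?thesis
    using l_nonneg by (simp add: intensity_eq power2_eq_square ennreal_mult)
qed

lemma nn_integral_emeasure_N_mult_disjoint:
  assumes "A \<in> sets nu" "B \<in> sets nu" "A \<inter> B = {}"
  shows "(\<integral>\<^sup>+w. emeasure (N w) A * emeasure (N w) B \<partial>M) = emeasure nu A * emeasure nu B"
proof -
  let ?B = "\<lambda>i::nat. if i = 0 then A else B"
  have "indep_vars (\<lambda>_. borel) (\<lambda>i w. emeasure (N w) (?B i)) {..<2}"
    using assms by (intro indep_vars_emeasure_N) (auto simp: disjoint_family_on_def)
  then have "(\<integral>\<^sup>+w. (\<Prod>i<2. emeasure (N w) (?B i)) \<partial>M) = (\<Prod>i<2. \<integral>\<^sup>+w. emeasure (N w) (?B i) \<partial>M)"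
    by (intro indep_vars_nn_integral) auto
  then show ?thesis
    using assms by (simp add: numeral_2_eq_2 nn_integral_emeasure_N)
qed

lemma nn_integral_emeasure_N_mult:
  assumes A_sets [measurable]: "A \<in> sets nu" and B_sets [measurable]: "B \<in> sets nu"
  shows "(\<integral>\<^sup>+w. emeasure (N w) A * emeasure (N w) B \<partial>M)
    = emeasure nu A * emeasure nu B + emeasure nu (A \<inter> B)"
proof -
  define a b c where "a w = emeasure (N w) (A - B)" and "b w = emeasure (N w) (B - A)"
    and "c w = emeasure (N w) (A \<inter> B)" for w
  have [measurable]: "a \<in> borel_measurable M" "b \<in> borel_measurable M" "c \<in> borel_measurable M"
    by (auto simp: a_def[abs_def] b_def[abs_def] c_def[abs_def])
  have emeasure_split: "emeasure m C = emeasure m (C - D) + emeasure m (C \<inter> D)"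
    if "sets m = sets nu" "C \<in> sets nu" "D \<in> sets nu" for m C D
    using that by (subst plus_emeasure) (auto simp: Un_Diff_Int)
  have "(\<integral>\<^sup>+w. emeasure (N w) A * emeasure (N w) B \<partial>M)
      = (\<integral>\<^sup>+w. a w * b w + a w * c w + (c w * b w + c w * c w) \<partial>M)"
    by (intro nn_integral_cong)
      (simp add: emeasure_split[OF sets_N A_sets B_sets] emeasure_split[OF sets_N B_sets A_sets]
        Int_commute a_def b_def c_def algebra_simps)
  also have "\<dots> = (\<integral>\<^sup>+w. a w * b w \<partial>M) + (\<integral>\<^sup>+w. a w * c w \<partial>M)
      + ((\<integral>\<^sup>+w. c w * b w \<partial>M) + (\<integral>\<^sup>+w. c w * c w \<partial>M))"
    by (simp add: nn_integral_add)
  also have "\<dots> = emeasure nu (A - B) * emeasure nu (B - A) + emeasure nu (A - B) * emeasure nu (A \<inter> B)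
      + (emeasure nu (A \<inter> B) * emeasure nu (B - A)
      + (emeasure nu (A \<inter> B) * emeasure nu (A \<inter> B) + emeasure nu (A \<inter> B)))"
    unfolding a_def b_def c_def
    by (intro arg_cong2[where f = "(+)"] nn_integral_emeasure_N_mult_disjoint
        nn_integral_emeasure_N_square) auto
  also have "\<dots> = emeasure nu A * emeasure nu B + emeasure nu (A \<inter> B)"
    by (simp add: emeasure_split[OF refl A_sets B_sets] emeasure_split[OF refl B_sets A_sets]
        Int_commute algebra_simps)
  finally show ?thesis .
qed

lemma nn_integral_Campbell:
  assumes "g \<in> borel_measurable nu"
  shows "(\<integral>\<^sup>+w. (\<integral>\<^sup>+z. g z \<partial>N w) \<partial>M) = (\<integral>\<^sup>+z. g z \<partial>nu)"
  using nn_integral_Campbell_weighted[OF assms, of "\<lambda>_. 1" nu] by (simp add: nn_integral_emeasure_N)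

lemma nn_integral_Campbell_mult:
  assumes [measurable]: "g \<in> borel_measurable nu" "h \<in> borel_measurable nu"
  shows "(\<integral>\<^sup>+w. (\<integral>\<^sup>+z. g z \<partial>N w) * (\<integral>\<^sup>+z. h z \<partial>N w) \<partial>M)
    = (\<integral>\<^sup>+z. g z \<partial>nu) * (\<integral>\<^sup>+z. h z \<partial>nu) + (\<integral>\<^sup>+z. g z * h z \<partial>nu)"
proof -
  have mixed: "(\<integral>\<^sup>+w. (\<integral>\<^sup>+z. g z \<partial>N w) * emeasure (N w) A \<partial>M)
      = (\<integral>\<^sup>+z. g z \<partial>nu) * emeasure nu A + (\<integral>\<^sup>+z. g z * indicator A z \<partial>nu)"
    if [measurable]: "A \<in> sets nu" for A
  proof -
    have "(\<integral>\<^sup>+w. emeasure (N w) A * (\<integral>\<^sup>+z. g z \<partial>N w) \<partial>M)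
        = (\<integral>\<^sup>+z. g z \<partial>density nu (\<lambda>z. emeasure nu A + indicator A z))"
      by (intro nn_integral_Campbell_weighted)
        (auto simp: nn_integral_emeasure_N_mult emeasure_density distrib_right nn_integral_add
          nn_integral_cmult indicator_inter_arith[symmetric])
    also have "\<dots> = emeasure nu A * (\<integral>\<^sup>+z. g z \<partial>nu) + (\<integral>\<^sup>+z. indicator A z * g z \<partial>nu)"
      by (simp add: nn_integral_density distrib_right nn_integral_add nn_integral_cmult)
    finally show ?thesis
      by (simp only: mult.commute)
  qed
  have "(\<integral>\<^sup>+w. (\<integral>\<^sup>+z. g z \<partial>N w) * (\<integral>\<^sup>+z. h z \<partial>N w) \<partial>M)
      = (\<integral>\<^sup>+z. h z \<partial>density nu (\<lambda>z. (\<integral>\<^sup>+z. g z \<partial>nu) + g z))"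
    by (intro nn_integral_Campbell_weighted)
      (auto simp: mixed emeasure_density distrib_right nn_integral_add nn_integral_cmult)
  then show ?thesis
    by (simp add: nn_integral_density distrib_right nn_integral_add nn_integral_cmult)
qed

lemma AE_integrable_N:
  fixes h :: "'b \<Rightarrow> real"
  assumes "integrable nu h"
  shows "AE w in M. integrable (N w) h"
proof -
  have "(\<integral>\<^sup>+w. (\<integral>\<^sup>+z. ennreal (norm (h z)) \<partial>N w) \<partial>M) < \<infinity>"
    using assms by (subst nn_integral_Campbell) (auto simp: integrable_iff_bounded)
  then have "AE w in M. (\<integral>\<^sup>+z. ennreal (norm (h z)) \<partial>N w) \<noteq> \<infinity>"
    using assms by (intro nn_integral_PInf_AE) auto
  then show ?thesis
    using AE_space
  proof eventually_elim
    case (elim w)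
    then show ?case
      using measurable_N[OF elim(2) borel_measurable_integrable[OF assms]]
      by (simp add: integrable_iff_bounded top.not_eq_extremum)
  qed
qed

lemma measurable_integral_N [measurable]:
  fixes h :: "'b \<Rightarrow> real"
  assumes [measurable]: "h \<in> borel_measurable nu" and "\<And>z. 0 \<le> h z"
  shows "(\<lambda>w. \<integral>z. h z \<partial>N w) \<in> borel_measurable M"
proof -
  have "(\<lambda>w. enn2real (\<integral>\<^sup>+z. ennreal (h z) \<partial>N w)) \<in> borel_measurable M"
    by measurable
  then show ?thesis
    using assms(2) by (simp add: integral_eq_nn_integral measurable_N cong: measurable_cong)
qed

lemma Campbell_variance:
  fixes h :: "'b \<Rightarrow> real"
  assumes integrable: "integrable nu h" "integrable nu (\<lambda>z. (h z)\<^sup>2)" and nonneg: "\<And>z. 0 \<le> h z"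
  shows "(\<integral>\<^sup>+w. ennreal (((\<integral>z. h z \<partial>N w) - (\<integral>z. h z \<partial>nu))\<^sup>2) \<partial>M) = ennreal (\<integral>z. (h z)\<^sup>2 \<partial>nu)"
proof (rule nn_integral_variance)
  note [measurable] = borel_measurable_integrable[OF integrable(1)]
  have integral_N_eq: "AE w in M. ennreal (\<integral>z. h z \<partial>N w) = (\<integral>\<^sup>+z. ennreal (h z) \<partial>N w)"
    using AE_integrable_N[OF integrable(1)]
    by eventually_elim (simp add: nn_integral_eq_integral nonneg)
  show "(\<integral>\<^sup>+w. ennreal (\<integral>z. h z \<partial>N w) \<partial>M) = ennreal (\<integral>z. h z \<partial>nu)"
    using integrable(1) nonneg
    by (simp add: nn_integral_cong_AE[OF integral_N_eq] nn_integral_Campbell nn_integral_eq_integral)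
  have "(\<integral>\<^sup>+w. ennreal ((\<integral>z. h z \<partial>N w)\<^sup>2) \<partial>M)
      = (\<integral>\<^sup>+w. (\<integral>\<^sup>+z. ennreal (h z) \<partial>N w) * (\<integral>\<^sup>+z. ennreal (h z) \<partial>N w) \<partial>M)"
  proof (rule nn_integral_cong_AE, use integral_N_eq in eventually_elim)
    case (elim w)
    then show ?case
      by (simp add: power2_eq_square ennreal_mult nonneg flip: elim)
  qed
  also have "\<dots> = ennreal (\<integral>z. h z \<partial>nu) * ennreal (\<integral>z. h z \<partial>nu) + ennreal (\<integral>z. (h z)\<^sup>2 \<partial>nu)"
    using integrable nonneg
    by (simp add: nn_integral_Campbell_mult nn_integral_eq_integral power2_eq_square flip: ennreal_mult)
  also have "\<dots> = ennreal ((\<integral>z. h z \<partial>nu)\<^sup>2 + (\<integral>z. (h z)\<^sup>2 \<partial>nu))"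
    using nonneg by (simp add: power2_eq_square ennreal_mult ennreal_plus)
  finally show "(\<integral>\<^sup>+w. ennreal ((\<integral>z. h z \<partial>N w)\<^sup>2) \<partial>M)
      = ennreal ((\<integral>z. h z \<partial>nu)\<^sup>2 + (\<integral>z. (h z)\<^sup>2 \<partial>nu))" .
qed (use integrable nonneg in auto)

lemma prob_emeasure_N_nonzero_le:
  assumes B_sets [measurable]: "B \<in> sets nu" and B_finite: "emeasure nu B < \<infinity>"
  shows "prob {w\<in>space M. emeasure (N w) B \<noteq> 0} \<le> measure nu B"
proof -
  have "{w\<in>space M. emeasure (N w) B \<noteq> 0} = space M - {w\<in>space M. emeasure (N w) B = of_nat 0}"
    by auto
  then have "prob {w\<in>space M. emeasure (N w) B \<noteq> 0} = 1 - exp (- measure nu B)"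
    using prob_emeasure_N_eq[OF B_sets B_finite, of 0] by (simp add: prob_compl)
  also have "\<dots> \<le> measure nu B"
    using exp_ge_add_one_self[of "- measure nu B"] by simp
  finally show ?thesis .
qed

lemma prm_distr_restrict:
  assumes [measurable]: "S \<in> sets nu" "f \<in> measurable nu L"
  shows "prm M (\<lambda>w. distr (density (N w) (indicator S)) L f) (distr (density nu (indicator S)) L f)"
proof -
  let ?K = "\<lambda>w. distr (density (N w) (indicator S)) L f"
  let ?intensity = "distr (density nu (indicator S)) L f"
  let ?pre = "\<lambda>B. S \<inter> (f -` B \<inter> space nu)"
  have emeasure_K: "emeasure (?K w) B = emeasure (N w) (?pre B)" if "w \<in> space M" "B \<in> sets L" for w B
    using that by (simp add: emeasure_distr_restricted sets_N measurable_N space_N)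
  have pre_sets: "?pre B \<in> sets nu" if "B \<in> sets L" for B
    using that by measurable
  show ?thesis
    unfolding prm_def poisson_random_measure_def
  proof (intro conjI ballI allI impI)
    fix n :: nat and B :: "nat \<Rightarrow> _"
    assume B_sets: "(\<forall>i<n. B i \<in> sets ?intensity) \<and> disjoint_family_on B {..<n}"
    then have "indep_vars (\<lambda>_. borel) (\<lambda>i w. emeasure (N w) (?pre (B i))) {..<n}"
      by (intro indep_vars_emeasure_N pre_sets) (auto simp: disjoint_family_on_def)
    then show "indep_vars (\<lambda>_. borel) (\<lambda>i w. emeasure (?K w) (B i)) {..<n}"
      using B_sets by (subst indep_vars_cong_on_space[OF emeasure_K]) auto
  next
    fix B assume "B \<in> sets ?intensity"
    then have B_sets: "B \<in> sets L"
      by simp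
    then show "(\<lambda>w. emeasure (?K w) B) \<in> borel_measurable M"
      using pre_sets by (simp add: emeasure_K cong: measurable_cong)
    have emeasure_intensity: "emeasure ?intensity B = emeasure nu (?pre B)"
      using B_sets by (simp add: emeasure_distr_restricted)
    show "prob {w\<in>space M. emeasure (?K w) B = of_nat k}
        = exp (- enn2real (emeasure ?intensity B)) * enn2real (emeasure ?intensity B) ^ k / fact k"
      if "emeasure ?intensity B < \<infinity>" for k
      using that prob_emeasure_N_eq[OF pre_sets[OF B_sets], of k] B_sets
      by (simp add: emeasure_intensity emeasure_K measure_def cong: conj_cong)
    show "AE w in M. emeasure (?K w) B = \<infinity>" if "emeasure ?intensity B = \<infinity>"
      using AE_emeasure_N_top[OF pre_sets[OF B_sets]] that AE_space
      by (auto simp: emeasure_intensity emeasure_K[OF _ B_sets])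
  qed (use prob_space_axioms in auto)
qed

end

section \<open>Geometric sums and interpolation\<close>

lemma suminf_powers_below_le:
  fixes b x :: real
  assumes b_gt_1: "1 < b" and x_nonneg: "0 \<le> x"
  shows "(\<Sum>k. ennreal (b ^ k * indicator {b ^ k<..} x)) \<le> ennreal (b / (b - 1) * x)"
proof (rule suminf_ennreal_le)
  fix n
  have "(b - 1) * (\<Sum>k<n. b ^ k * indicator {b ^ k<..} x)
      \<le> (\<Sum>k<n. min (b ^ Suc k) (b * x) - min (b ^ k) (b * x))"
    unfolding sum_distrib_left
  proof (rule sum_mono)
    fix k
    show "(b - 1) * (b ^ k * indicator {b ^ k<..} x) \<le> min (b ^ Suc k) (b * x) - min (b ^ k) (b * x)"
    proof (cases "b ^ k < x")
      case True
      moreover have "b ^ k \<le> b * b ^ k"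
        using b_gt_1 by simp
      moreover have "b * b ^ k \<le> b * x"
        using b_gt_1 True by simp
      ultimately show ?thesis
        by (simp add: algebra_simps)
    next
      case False
      then show ?thesis
        using b_gt_1 by (simp add: min_def)
    qed
  qed
  also have "\<dots> = min (b ^ n) (b * x) - min 1 (b * x)"
    by (subst sum_lessThan_telescope) simp
  also have "\<dots> \<le> b * x"
    using b_gt_1 x_nonneg min.cobounded2[of "b ^ n" "b * x"] by (smt (verit) mult_nonneg_nonneg)
  finally show "(\<Sum>k<n. b ^ k * indicator {b ^ k<..} x) \<le> b / (b - 1) * x"
    using b_gt_1 by (simp add: field_simps)
qed (use b_gt_1 in auto)

definition truncate :: "real \<Rightarrow> real \<Rightarrow> real" where
  "truncate c x = (if x \<le> c then x else 0)"

lemma measurable_truncate [measurable]: "truncate c \<in> borel_measurable borel"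
  unfolding truncate_def[abs_def] by measurable

lemma truncate_nonneg: "0 \<le> x \<Longrightarrow> 0 \<le> truncate c x"
  and truncate_le: "0 \<le> x \<Longrightarrow> truncate c x \<le> x"
  by (auto simp: truncate_def)

lemma truncate_square_le: "0 \<le> c \<Longrightarrow> 0 \<le> x \<Longrightarrow> (truncate c x)\<^sup>2 \<le> c * x"
  by (auto simp: truncate_def power2_eq_square intro: mult_right_mono)

lemma suminf_truncate_powers_square_le:
  fixes b x :: real
  assumes b_gt_1: "1 < b" and x_nonneg: "0 \<le> x"
  shows "(\<Sum>k. ennreal ((truncate (b ^ k) x)\<^sup>2 / b ^ k)) \<le> ennreal (b / (b - 1) * x)"
proof (rule suminf_ennreal_le)
  fix n
  define d where "d k = min x (x\<^sup>2 / b ^ k)" for k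
  have "(b - 1) * ((truncate (b ^ k) x)\<^sup>2 / b ^ k) \<le> b * (d k - d (Suc k))" for k
  proof (cases "x \<le> b ^ k")
    case True
    then have "x \<le> b ^ Suc k"
      using b_gt_1 power_increasing[of k "Suc k" b] by linarith
    then have "x\<^sup>2 \<le> x * b ^ k" "x\<^sup>2 \<le> x * b ^ Suc k"
      using True x_nonneg unfolding power2_eq_square by (auto intro: mult_left_mono)
    then have "d k = x\<^sup>2 / b ^ k" "d (Suc k) = x\<^sup>2 / b ^ Suc k"
      using b_gt_1 by (simp_all add: d_def min_def field_simps)
    then show ?thesis
      using b_gt_1 True by (simp add: truncate_def field_simps)
  next
    case False
    have "x\<^sup>2 / b ^ Suc k \<le> x\<^sup>2 / b ^ k"
      using b_gt_1 by (intro divide_left_mono) auto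
    then show ?thesis
      using b_gt_1 False by (simp add: truncate_def d_def min_def)
  qed
  then have "(b - 1) * (\<Sum>k<n. (truncate (b ^ k) x)\<^sup>2 / b ^ k) \<le> b * (\<Sum>k<n. d k - d (Suc k))"
    unfolding sum_distrib_left by (intro sum_mono)
  also have "\<dots> = b * (d 0 - d n)"
    by (simp only: sum_lessThan_telescope')
  also have "\<dots> \<le> b * x"
  proof (rule mult_left_mono)
    have "d 0 \<le> x" "0 \<le> d n"
      using b_gt_1 x_nonneg by (simp_all add: d_def)
    then show "d 0 - d n \<le> x"
      by simp
  qed (use b_gt_1 in simp)
  finally show "(\<Sum>k<n. (truncate (b ^ k) x)\<^sup>2 / b ^ k) \<le> b / (b - 1) * x"
    using b_gt_1 by (simp add: field_simps)
qed (use b_gt_1 in auto)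

lemma ex_power_sandwich:
  fixes a b :: real
  assumes b_gt_1: "1 < b" and power_le_a: "b ^ K \<le> a"
  shows "\<exists>k\<ge>K. b ^ k \<le> a \<and> a < b ^ Suc k"
proof -
  define n where "n = (LEAST n. a < b ^ n)"
  have a_less_power: "a < b ^ n"
    unfolding n_def using real_arch_pow[OF b_gt_1] by (rule LeastI_ex)
  then have "K < n"
    using power_le_a power_less_imp_less_exp[OF b_gt_1, of K n] by simp
  then obtain k where n_eq: "n = Suc k" "K \<le> k"
    by (cases n) auto
  then have "b ^ k \<le> a"
    using not_less_Least[of k "\<lambda>n. a < b ^ n"] by (auto simp: n_def)
  with n_eq a_less_power show ?thesis
    by auto
qed

lemma eventually_div_self_bounds_of_geometric:
  fixes F :: "real \<Rightarrow> real"
  assumes b_gt_1: "1 < b" and mono: "mono_on {0<..} F" and nonneg: "\<And>x. 0 < x \<Longrightarrow> 0 \<le> F x"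
    and lim: "(\<lambda>k. F (b ^ k) / b ^ k) \<longlonglongrightarrow> L" and bounds: "b * l < L" "L < u / b"
  shows "\<forall>\<^sub>F a in at_top. l < F a / a \<and> F a / a < u"
proof -
  obtain K where K_bounds: "b * l < F (b ^ k) / b ^ k" "F (b ^ k) / b ^ k < u / b" if "K \<le> k" for k
    using eventually_conj[OF order_tendstoD(1)[OF lim bounds(1)] order_tendstoD(2)[OF lim bounds(2)]]
    by (auto simp: eventually_sequentially)
  show ?thesis
    using eventually_ge_at_top[of "b ^ K"]
  proof eventually_elim
    case (elim a)
    then obtain k where sandwich: "K \<le> k" "b ^ k \<le> a" "a < b ^ Suc k"
      using ex_power_sandwich[OF b_gt_1] by blast
    have powers_pos: "0 < b ^ k" "0 < b ^ Suc k"
      using b_gt_1 by simp_all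
    then have "0 < a"
      using sandwich by linarith
    have "F a / a \<le> F (b ^ Suc k) / b ^ k"
      using sandwich powers_pos \<open>0 < a\<close> nonneg by (intro frac_le mono_onD[OF mono]) auto
    also have "\<dots> = b * (F (b ^ Suc k) / b ^ Suc k)"
      using b_gt_1 by simp
    also have "\<dots> < b * (u / b)"
      using K_bounds(2)[of "Suc k"] sandwich b_gt_1 by (intro mult_strict_left_mono) auto
    finally have "F a / a < u"
      using b_gt_1 by simp
    moreover have "l < (F (b ^ k) / b ^ k) / b"
      using K_bounds(1)[OF sandwich(1)] b_gt_1 by (simp add: field_simps)
    moreover have "(F (b ^ k) / b ^ k) / b = F (b ^ k) / b ^ Suc k"
      by (simp add: field_simps)
    moreover have "F (b ^ k) / b ^ Suc k \<le> F a / a"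
      using sandwich powers_pos \<open>0 < a\<close> nonneg by (intro frac_le mono_onD[OF mono]) auto
    ultimately show ?case
      by linarith
  qed
qed

lemma tendsto_div_self_of_geometric:
  fixes F :: "real \<Rightarrow> real" and b :: "nat \<Rightarrow> real"
  assumes mono: "mono_on {0<..} F" and nonneg: "\<And>x. 0 < x \<Longrightarrow> 0 \<le> F x"
    and b_gt_1: "\<And>j. 1 < b j" and b_lim: "b \<longlonglongrightarrow> 1"
    and lim: "\<And>j. (\<lambda>k. F (b j ^ k) / b j ^ k) \<longlonglongrightarrow> L"
  shows "((\<lambda>a. F a / a) \<longlongrightarrow> L) at_top"
proof (rule tendstoI)
  fix e :: real assume e_pos: "0 < e"
  have "(\<lambda>j. b j * c) \<longlonglongrightarrow> c" for c
    using tendsto_mult[OF b_lim tendsto_const] by simp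
  then have "\<forall>\<^sub>F j in sequentially. b j * (L - e) < L \<and> b j * L < L + e"
    using e_pos by (intro eventually_conj order_tendstoD(2)) auto
  then obtain j where j_bounds: "b j * (L - e) < L" "b j * L < L + e"
    by (auto simp: eventually_sequentially)
  have "\<forall>\<^sub>F a in at_top. L - e < F a / a \<and> F a / a < L + e"
    using j_bounds b_gt_1[of j]
    by (intro eventually_div_self_bounds_of_geometric[OF b_gt_1 mono nonneg lim])
      (auto simp: field_simps)
  then show "\<forall>\<^sub>F a in at_top. dist (F a / a) L < e"
    by eventually_elim (simp add: dist_real_def abs_less_iff)
qed

section \<open>The strong law for increasing Poisson random measures\<close>

lemma AE_tendsto_0_of_suminf_nn_integral_square:
  fixes D :: "nat \<Rightarrow> 'a \<Rightarrow> real"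
  assumes [measurable]: "\<And>k. D k \<in> borel_measurable M"
    and sum_finite: "(\<Sum>k. \<integral>\<^sup>+w. ennreal ((D k w)\<^sup>2) \<partial>M) < \<infinity>"
  shows "AE w in M. (\<lambda>k. D k w) \<longlonglongrightarrow> 0"
proof -
  have "(\<integral>\<^sup>+w. (\<Sum>k. ennreal ((D k w)\<^sup>2)) \<partial>M) < \<infinity>"
    using sum_finite by (subst nn_integral_suminf) auto
  then have "AE w in M. (\<Sum>k. ennreal ((D k w)\<^sup>2)) \<noteq> \<infinity>"
    by (intro nn_integral_PInf_AE) auto
  then show ?thesis
  proof eventually_elim
    case (elim w)
    then have "summable (\<lambda>k. (D k w)\<^sup>2)"
      by (intro summable_suminf_not_top) auto
    then have "(\<lambda>k. sqrt ((D k w)\<^sup>2)) \<longlonglongrightarrow> sqrt 0"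
      by (intro tendsto_real_sqrt summable_LIMSEQ_zero)
    then show ?case
      by (simp add: tendsto_rabs_zero_iff)
  qed
qed

lemma integral_truncate_LIMSEQ:
  fixes F :: "'a \<Rightarrow> real"
  assumes F_integrable: "integrable mu F" and F_nonneg: "\<And>z. 0 \<le> F z"
    and c_lim: "filterlim c at_top sequentially"
  shows "(\<lambda>k. \<integral>z. truncate (c k) (F z) \<partial>mu) \<longlonglongrightarrow> (\<integral>z. F z \<partial>mu)"
proof (rule integral_dominated_convergence)
  note [measurable] = borel_measurable_integrable[OF F_integrable]
  show "AE z in mu. (\<lambda>k. truncate (c k) (F z)) \<longlonglongrightarrow> F z"
  proof (rule AE_I2, rule tendsto_eventually)
    fix z
    show "\<forall>\<^sub>F k in sequentially. truncate (c k) (F z) = F z"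
      using c_lim[unfolded filterlim_at_top, rule_format, of "F z"]
      by eventually_elim (simp add: truncate_def)
  qed
  show "AE z in mu. norm (truncate (c k) (F z)) \<le> F z" for k
    using F_nonneg by (simp add: truncate_nonneg truncate_le)
qed (use F_integrable F_nonneg in measurable)

lemma suminf_nn_integral_comp_finite:
  fixes F :: "'a \<Rightarrow> real" and h :: "nat \<Rightarrow> real \<Rightarrow> real"
  assumes F_integrable: "integrable mu F" and F_nonneg: "\<And>z. 0 \<le> F z"
    and [measurable]: "\<And>k. h k \<in> borel_measurable borel"
    and bound: "\<And>x. 0 \<le> x \<Longrightarrow> (\<Sum>k. ennreal (h k x)) \<le> ennreal (C * x)"
  shows "(\<Sum>k. \<integral>\<^sup>+z. ennreal (h k (F z)) \<partial>mu) < \<infinity>"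
proof -
  note [measurable] = borel_measurable_integrable[OF F_integrable]
  have "(\<Sum>k. \<integral>\<^sup>+z. ennreal (h k (F z)) \<partial>mu) = (\<integral>\<^sup>+z. (\<Sum>k. ennreal (h k (F z))) \<partial>mu)"
    by (intro nn_integral_suminf[symmetric]) auto
  also have "\<dots> \<le> (\<integral>\<^sup>+z. ennreal (norm (C * F z)) \<partial>mu)"
    by (intro nn_integral_mono order_trans[OF bound[OF F_nonneg]] ennreal_leI) simp
  also have "\<dots> < \<infinity>"
    using integrable_mult_right[OF F_integrable, of C] unfolding integrable_iff_bounded by blast
  finally show ?thesis .
qed

text \<open>Only the marginal laws and monotonicity in \<open>a\<close> enter, so nothing is assumed about the joint
  law of the \<open>K a\<close>, such as independence of increments.\<close>

locale homogeneous_prm =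
  fixes M :: "'w measure" and K :: "real \<Rightarrow> 'w \<Rightarrow> 'b measure" and mu :: "'b measure"
  assumes prm_K: "0 < a \<Longrightarrow> prm M (K a) (density mu (\<lambda>_. ennreal a))"
    and K_mono: "w \<in> space M \<Longrightarrow> 0 < a \<Longrightarrow> a \<le> c \<Longrightarrow> K a w \<le> K c w"
begin

sublocale prob_space M
  using prm_K[of 1] by (simp add: prm_def poisson_random_measure_def)

lemma sets_K: "w \<in> space M \<Longrightarrow> 0 < a \<Longrightarrow> sets (K a w) = sets mu"
  using prm_K[of a] by (simp add: prm_def poisson_random_measure_def)

lemma integrable_intensity:
  fixes F :: "'b \<Rightarrow> real"
  shows "integrable mu F \<Longrightarrow> 0 < a \<Longrightarrow> integrable (density mu (\<lambda>_. ennreal a)) F"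
  by (subst integrable_density) auto

lemma nn_integral_K_mono:
  assumes "w \<in> space M" "0 < a" "a \<le> c"
  shows "(\<integral>\<^sup>+z. g z \<partial>K a w) \<le> (\<integral>\<^sup>+z. g z \<partial>K c w)"
  using assms by (intro nn_integral_mono_measure K_mono) (auto simp: sets_K)

lemma integrable_K_mono:
  fixes F :: "'b \<Rightarrow> real"
  assumes w_in_space: "w \<in> space M" and a_le_c: "0 < a" "a \<le> c" and F_integrable: "integrable (K c w) F"
  shows "integrable (K a w) F"
proof -
  have "sets (K a w) = sets (K c w)"
    using w_in_space a_le_c by (simp add: sets_K)
  then have "F \<in> borel_measurable (K a w)"
    using F_integrable measurable_cong_sets by blast
  with F_integrable nn_integral_K_mono[OF w_in_space a_le_c] show ?thesis
    unfolding integrable_iff_bounded by (auto intro: le_less_trans)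
qed

lemma integral_K_mono:
  fixes F :: "'b \<Rightarrow> real"
  assumes w_in_space: "w \<in> space M" and a_le_c: "0 < a" "a \<le> c"
    and F_integrable: "integrable (K c w) F" and F_nonneg: "\<And>z. 0 \<le> F z"
  shows "(\<integral>z. F z \<partial>K a w) \<le> (\<integral>z. F z \<partial>K c w)"
proof -
  have "ennreal (\<integral>z. F z \<partial>K a w) \<le> ennreal (\<integral>z. F z \<partial>K c w)"
    using nn_integral_K_mono[OF w_in_space a_le_c] F_integrable F_nonneg
      integrable_K_mono[OF w_in_space a_le_c F_integrable]
    by (simp flip: nn_integral_eq_integral)
  then show ?thesis
    using F_integrable F_nonneg by (simp add: ennreal_le_iff)
qed

lemma AE_integrable_K:
  fixes F :: "'b \<Rightarrow> real"
  assumes F_integrable: "integrable mu F"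
  shows "AE w in M. \<forall>a>0. integrable (K a w) F"
proof -
  have "AE w in M. \<forall>n. integrable (K (real (Suc n)) w) F"
    unfolding AE_all_countable
    by (intro allI prm.AE_integrable_N[OF prm_K] integrable_intensity F_integrable) simp_all
  then show ?thesis
    using AE_space
  proof eventually_elim
    case (elim w)
    show ?case
    proof (intro allI impI)
      fix a :: real assume "0 < a"
      moreover obtain n where "a \<le> real (Suc n)"
        using real_arch_simple[of a] by (metis le_Suc_eq of_nat_le_iff order_refl order_trans)
      ultimately show "integrable (K a w) F"
        using elim by (blast intro: integrable_K_mono)
    qed
  qed
qed

lemma nn_integral_centered_square:
  fixes h :: "'b \<Rightarrow> real"
  assumes a_pos: "0 < a" and h_integrable: "integrable mu h"
    and h_square_integrable: "integrable mu (\<lambda>z. (h z)\<^sup>2)" and h_nonneg: "\<And>z. 0 \<le> h z"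
  shows "(\<integral>\<^sup>+w. ennreal (((\<integral>z. h z \<partial>K a w) / a - (\<integral>z. h z \<partial>mu))\<^sup>2) \<partial>M)
    = (\<integral>\<^sup>+z. ennreal ((h z)\<^sup>2 / a) \<partial>mu)"
proof -
  interpret K: prm M "K a" "density mu (\<lambda>_. ennreal a)"
    using a_pos by (rule prm_K)
  have [measurable]: "h \<in> borel_measurable (density mu (\<lambda>_. ennreal a))"
    using h_integrable by auto
  have integral_intensity: "(\<integral>z. g z \<partial>density mu (\<lambda>_. ennreal a)) = a * (\<integral>z. g z \<partial>mu)"
    if "integrable mu g" for g :: "'b \<Rightarrow> real"
    using that a_pos by (subst integral_density) auto
  have "((\<integral>z. h z \<partial>K a w) / a - (\<integral>z. h z \<partial>mu))\<^sup>2
      = (1 / a)\<^sup>2 * ((\<integral>z. h z \<partial>K a w) - (\<integral>z. h z \<partial>density mu (\<lambda>_. ennreal a)))\<^sup>2" for w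
    using a_pos by (simp add: integral_intensity[OF h_integrable] field_simps flip: power_mult_distrib)
  then have "(\<integral>\<^sup>+w. ennreal (((\<integral>z. h z \<partial>K a w) / a - (\<integral>z. h z \<partial>mu))\<^sup>2) \<partial>M)
      = ennreal ((1 / a)\<^sup>2) * ennreal (\<integral>z. (h z)\<^sup>2 \<partial>density mu (\<lambda>_. ennreal a))"
    using h_nonneg K.Campbell_variance[OF integrable_intensity[OF h_integrable a_pos]
      integrable_intensity[OF h_square_integrable a_pos] h_nonneg]
    by (simp add: ennreal_mult nn_integral_cmult)
  also have "\<dots> = ennreal (\<integral>z. (h z)\<^sup>2 / a \<partial>mu)"
    unfolding integral_intensity[OF h_square_integrable] using a_pos
    by (simp add: power2_eq_square flip: ennreal_mult)
  also have "\<dots> = (\<integral>\<^sup>+z. ennreal ((h z)\<^sup>2 / a) \<partial>mu)"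
    using h_square_integrable a_pos by (intro nn_integral_eq_integral[symmetric]) auto
  finally show ?thesis .
qed

lemma AE_eventually_emeasure_K_eq_0:
  assumes a_pos: "\<And>k. 0 < a k" and [measurable]: "\<And>k. B k \<in> sets mu"
    and sum_finite: "(\<Sum>k. ennreal (a k) * emeasure mu (B k)) < \<infinity>"
  shows "AE w in M. \<forall>\<^sub>F k in sequentially. w \<in> space M \<and> emeasure (K (a k) w) (B k) = 0"
proof -
  let ?nu = "\<lambda>k. density mu (\<lambda>_. ennreal (a k))"
  let ?E = "\<lambda>k. {w\<in>space M. emeasure (K (a k) w) (B k) \<noteq> 0}"
  have nu_sum: "(\<Sum>k. emeasure (?nu k) (B k)) < \<infinity>"
    using sum_finite by (simp add: emeasure_density_const)
  then have nu_finite: "emeasure (?nu k) (B k) < \<infinity>" for k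
    using sum_le_suminf[of "\<lambda>k. emeasure (?nu k) (B k)" "{k}"] by (auto intro: le_less_trans)
  have prob_le: "prob (?E k) \<le> measure (?nu k) (B k)" and events: "?E k \<in> events" for k
  proof -
    interpret K: prm M "K (a k)" "?nu k"
      by (rule prm_K[OF a_pos])
    show "prob (?E k) \<le> measure (?nu k) (B k)"
      by (rule K.prob_emeasure_N_nonzero_le[OF _ nu_finite]) simp
    have [measurable]: "B k \<in> sets (?nu k)"
      by simp
    show "?E k \<in> events"
      by measurable
  qed
  have "summable (\<lambda>k. measure (?nu k) (B k))"
    using nu_sum nu_finite
    by (intro summable_suminf_not_top) (auto simp: emeasure_eq_ennreal_measure less_top)
  then have "summable (\<lambda>k. prob (?E k))"
    by (rule summable_comparison_test') (use prob_le in auto)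
  then have "AE w in M. \<forall>\<^sub>F k in sequentially. w \<in> space M - ?E k"
    by (intro borel_cantelli_AE1 events) (auto simp: emeasure_eq_measure)
  then show ?thesis
    by eventually_elim (erule eventually_mono, simp)
qed

lemma AE_eventually_integral_K_truncate:
  fixes F :: "'b \<Rightarrow> real"
  assumes F_integrable: "integrable mu F" and F_nonneg: "\<And>z. 0 \<le> F z" and b_gt_1: "1 < b"
  shows "AE w in M. \<forall>\<^sub>F k in sequentially.
    (\<integral>z. F z \<partial>K (b ^ k) w) = (\<integral>z. truncate (b ^ k) (F z) \<partial>K (b ^ k) w)"
proof -
  note [measurable] = borel_measurable_integrable[OF F_integrable]
  let ?B = "\<lambda>k. {z\<in>space mu. b ^ k < F z}"
  have power_pos: "0 < b ^ k" for k
    using b_gt_1 by simp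
  have "ennreal (b ^ k) * emeasure mu (?B k)
      = (\<integral>\<^sup>+z. ennreal (b ^ k * indicator {b ^ k<..} (F z)) \<partial>mu)" for k
    by (subst nn_integral_cmult_indicator[symmetric])
      (auto simp: power_pos intro!: nn_integral_cong split: split_indicator)
  then have "(\<Sum>k. ennreal (b ^ k) * emeasure mu (?B k)) < \<infinity>"
    using suminf_nn_integral_comp_finite[OF F_integrable F_nonneg _ suminf_powers_below_le[OF b_gt_1]]
    by simp
  then have "AE w in M. \<forall>\<^sub>F k in sequentially. w \<in> space M \<and> emeasure (K (b ^ k) w) (?B k) = 0"
    by (intro AE_eventually_emeasure_K_eq_0 power_pos) measurable
  then show ?thesis
  proof eventually_elim
    case (elim w)
    then show ?case
    proof eventually_elim
      case (elim k)
      then have sets_eq [measurable_cong]: "sets (K (b ^ k) w) = sets mu"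
        using power_pos by (simp add: sets_K)
      have "AE z in K (b ^ k) w. z \<notin> ?B k"
        using elim by (intro AE_not_in) (auto simp: null_sets_def sets_eq)
      then show ?case
        using sets_eq_imp_space_eq[OF sets_eq] by (intro integral_cong_AE) (auto simp: truncate_def)
    qed
  qed
qed

lemma AE_integral_K_truncate_centered:
  fixes F :: "'b \<Rightarrow> real"
  assumes F_integrable: "integrable mu F" and F_nonneg: "\<And>z. 0 \<le> F z" and b_gt_1: "1 < b"
  shows "AE w in M. (\<lambda>k. (\<integral>z. truncate (b ^ k) (F z) \<partial>K (b ^ k) w) / b ^ k
    - (\<integral>z. truncate (b ^ k) (F z) \<partial>mu)) \<longlonglongrightarrow> 0"
proof (rule AE_tendsto_0_of_suminf_nn_integral_square)
  note [measurable] = borel_measurable_integrable[OF F_integrable]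
  have power_pos: "0 < b ^ k" for k
    using b_gt_1 by simp
  have truncate_integrable: "integrable mu (\<lambda>z. truncate c (F z))" for c
    using F_integrable by (rule Bochner_Integration.integrable_bound)
      (auto simp: F_nonneg truncate_nonneg truncate_le)
  have truncate_square_integrable: "integrable mu (\<lambda>z. (truncate c (F z))\<^sup>2)" if "0 < c" for c
    by (rule Bochner_Integration.integrable_bound[OF integrable_mult_right[OF F_integrable, of c]])
      (use that in \<open>auto simp: F_nonneg truncate_square_le less_imp_le\<close>)
  show "(\<lambda>w. (\<integral>z. truncate (b ^ k) (F z) \<partial>K (b ^ k) w) / b ^ k
      - (\<integral>z. truncate (b ^ k) (F z) \<partial>mu)) \<in> borel_measurable M" for k
  proof -
    interpret K: prm M "K (b ^ k)" "density mu (\<lambda>_. ennreal (b ^ k))"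
      by (rule prm_K[OF power_pos])
    show ?thesis
      by (intro borel_measurable_diff borel_measurable_divide K.measurable_integral_N)
        (simp_all add: F_nonneg truncate_nonneg)
  qed
  show "(\<Sum>k. \<integral>\<^sup>+w. ennreal (((\<integral>z. truncate (b ^ k) (F z) \<partial>K (b ^ k) w) / b ^ k
      - (\<integral>z. truncate (b ^ k) (F z) \<partial>mu))\<^sup>2) \<partial>M) < \<infinity>"
    unfolding nn_integral_centered_square[OF power_pos truncate_integrable
      truncate_square_integrable[OF power_pos] truncate_nonneg[OF F_nonneg]]
    by (rule suminf_nn_integral_comp_finite[OF F_integrable F_nonneg _
          suminf_truncate_powers_square_le[OF b_gt_1]]) simp
qed

lemma AE_integral_K_geometric_LIMSEQ:
  fixes F :: "'b \<Rightarrow> real"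
  assumes F_integrable: "integrable mu F" and F_nonneg: "\<And>z. 0 \<le> F z" and b_gt_1: "1 < b"
  shows "AE w in M. (\<lambda>k. (\<integral>z. F z \<partial>K (b ^ k) w) / b ^ k) \<longlonglongrightarrow> (\<integral>z. F z \<partial>mu)"
  using AE_eventually_integral_K_truncate[OF assms] AE_integral_K_truncate_centered[OF assms]
proof eventually_elim
  case (elim w)
  have "filterlim (\<lambda>k. b ^ k) at_top sequentially"
    using b_gt_1
    by (intro filterlim_at_infinity_imp_filterlim_at_top filterlim_realpow_sequentially_gt1) auto
  from tendsto_add[OF elim(2) integral_truncate_LIMSEQ[OF F_integrable F_nonneg this]]
  have "(\<lambda>k. (\<integral>z. truncate (b ^ k) (F z) \<partial>K (b ^ k) w) / b ^ k) \<longlonglongrightarrow> (\<integral>z. F z \<partial>mu)"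
    by simp
  then show ?case
    by (rule Lim_transform_eventually) (use elim(1) in eventually_elim, simp)
qed

lemma integral_K_strong_law_nonneg:
  fixes F :: "'b \<Rightarrow> real"
  assumes F_integrable: "integrable mu F" and F_nonneg: "\<And>z. 0 \<le> F z"
  shows "AE w in M. ((\<lambda>a. (\<integral>z. F z \<partial>K a w) / a) \<longlongrightarrow> (\<integral>z. F z \<partial>mu)) at_top"
proof -
  define b where "b j = 1 + 1 / real (Suc j)" for j
  have b_gt_1: "1 < b j" for j
    by (simp add: b_def)
  have b_lim: "b \<longlonglongrightarrow> 1"
    using tendsto_add[OF tendsto_const LIMSEQ_inverse_real_of_nat, of 1]
    by (simp add: b_def[abs_def] inverse_eq_divide)
  have "AE w in M. \<forall>j. (\<lambda>k. (\<integral>z. F z \<partial>K (b j ^ k) w) / b j ^ k) \<longlonglongrightarrow> (\<integral>z. F z \<partial>mu)"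
    unfolding AE_all_countable
    by (intro allI AE_integral_K_geometric_LIMSEQ F_integrable F_nonneg b_gt_1)
  then show ?thesis
    using AE_integrable_K[OF F_integrable] AE_space
  proof eventually_elim
    case (elim w)
    then show ?case
      by (intro tendsto_div_self_of_geometric[OF _ _ b_gt_1 b_lim] mono_onI integral_K_mono)
        (auto intro: integral_nonneg simp: F_nonneg)
  qed
qed

theorem integral_K_strong_law:
  fixes F :: "'b \<Rightarrow> real"
  assumes F_integrable: "integrable mu F"
  shows "AE w in M. ((\<lambda>a. (\<integral>z. F z \<partial>K a w) / a) \<longlongrightarrow> (\<integral>z. F z \<partial>mu)) at_top"
proof -
  let ?pos = "\<lambda>z. max 0 (F z)" and ?neg = "\<lambda>z. max 0 (- F z)"
  have parts_integrable: "integrable m ?pos" "integrable m ?neg" if "integrable m F" for m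
    using that by (auto intro: integrable_max)
  have integral_eq_diff: "(\<integral>z. F z \<partial>m) = (\<integral>z. ?pos z \<partial>m) - (\<integral>z. ?neg z \<partial>m)" if "integrable m F" for m
  proof -
    have "(\<integral>z. F z \<partial>m) = (\<integral>z. ?pos z - ?neg z \<partial>m)"
      by (intro Bochner_Integration.integral_cong) auto
    then show ?thesis
      using parts_integrable[OF that] by (simp only: Bochner_Integration.integral_diff)
  qed
  show ?thesis
    using integral_K_strong_law_nonneg[OF parts_integrable(1)[OF F_integrable] max.cobounded1]
      integral_K_strong_law_nonneg[OF parts_integrable(2)[OF F_integrable] max.cobounded1]
      AE_integrable_K[OF F_integrable]
  proof eventually_elim
    case (elim w)
    then have "((\<lambda>a. (\<integral>z. ?pos z \<partial>K a w) / a - (\<integral>z. ?neg z \<partial>K a w) / a) \<longlongrightarrow> (\<integral>z. F z \<partial>mu)) at_top"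
      unfolding integral_eq_diff[OF F_integrable] by (intro tendsto_diff)
    moreover have "\<forall>\<^sub>F a in at_top. (\<integral>z. ?pos z \<partial>K a w) / a - (\<integral>z. ?neg z \<partial>K a w) / a
        = (\<integral>z. F z \<partial>K a w) / a"
      using eventually_gt_at_top[of 0]
      by eventually_elim (simp add: integral_eq_diff elim(3) diff_divide_distrib)
    ultimately show ?case
      by (rule Lim_transform_eventually)
  qed
qed

end

section \<open>Normalized completely random measures\<close>

lemma emeasure_space_eq_measure_of_pos:
  assumes "0 < measure m A"
  shows "emeasure m A = ennreal (measure m A)"
  using assms by (metis emeasure_eq_ennreal_measure less_irrefl measure_zero_top)

context
  fixes m :: "'a measure"
  assumes mass_pos: "0 < measure m (space m)"
begin

lemma density_inverse_mass:
  "density m (\<lambda>_. inverse (emeasure m (space m))) = density m (\<lambda>_. ennreal (1 / measure m (space m)))"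
  using mass_pos by (simp add: emeasure_space_eq_measure_of_pos inverse_ennreal inverse_eq_divide)

lemma prob_space_density_inverse_mass:
  "prob_space (density m (\<lambda>_. inverse (emeasure m (space m))))"
  unfolding density_inverse_mass
  using mass_pos by (intro prob_spaceI)
    (simp add: emeasure_density_const emeasure_space_eq_measure_of_pos flip: ennreal_mult)

lemma integral_density_inverse_mass:
  fixes f :: "'a \<Rightarrow> real"
  assumes "f \<in> borel_measurable m"
  shows "(\<integral>x. f x \<partial>density m (\<lambda>_. inverse (emeasure m (space m)))) = (\<integral>x. f x \<partial>m) / measure m (space m)"
  unfolding density_inverse_mass using assms by (subst integral_density) auto

end

lemma sigma_finite_measure_of_integrable_pos:
  fixes f :: "'a \<Rightarrow> real"
  assumes f_integrable: "integrable m f" and f_pos: "AE x in m. 0 < f x"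
  shows "sigma_finite_measure m"
proof
  note [measurable] = borel_measurable_integrable[OF f_integrable]
  let ?A = "insert {x\<in>space m. f x \<le> 0} (range (\<lambda>n::nat. {x\<in>space m. 1 / real (Suc n) \<le> f x}))"
  have "x \<in> \<Union>?A" if x_in_space: "x \<in> space m" for x
  proof (cases "0 < f x")
    case True
    then obtain n where "1 / real (Suc n) < f x"
      by (rule nat_approx_posE)
    then have "x \<in> {x\<in>space m. 1 / real (Suc n) \<le> f x}"
      using x_in_space by simp
    then show ?thesis
      by blast
  qed (use x_in_space in simp)
  then have "\<Union>?A = space m"
    by auto
  moreover have "emeasure m {x\<in>space m. f x \<le> 0} = 0"
    using f_pos by (subst (asm) AE_iff_measurable[OF _ refl]) (auto simp: not_less)
  moreover have "emeasure m {x\<in>space m. 1 / real (Suc n) \<le> f x} \<noteq> \<infinity>" for n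
  proof -
    have "AE x in m. 0 \<le> f x"
      using f_pos by eventually_elim simp
    from integral_Markov_inequality[OF f_integrable this, of "1 / real (Suc n)"] show ?thesis
      by (auto simp: top_unique simp del: of_nat_Suc)
  qed
  ultimately show "\<exists>A. countable A \<and> A \<subseteq> sets m \<and> \<Union> A = space m \<and> (\<forall>a\<in>A. emeasure m a \<noteq> \<infinity>)"
    by (intro exI[of _ ?A]) auto
qed

lemma integrable_bounded_continuous:
  fixes f :: "'a::topological_space \<Rightarrow> real"
  assumes "finite_measure m" "sets m = sets borel" "continuous_on UNIV f" "bounded (range f)"
  shows "integrable m f"
proof -
  obtain B where "norm (f x) \<le> B" for x
    using assms(4) unfolding bounded_iff by auto
  moreover have "f \<in> borel_measurable m"
    using assms(2,3) borel_measurable_continuous_onI measurable_cong_sets by blast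
  ultimately show ?thesis
    using assms(1) by (intro finite_measure.integrable_const_bound[of m f B]) auto
qed

lemma dM_tendsto_0:
  fixes f :: "nat \<Rightarrow> 'a \<Rightarrow> real"
  assumes "\<And>i. ((\<lambda>a. \<integral>x. f i x \<partial>P a) \<longlongrightarrow> (\<integral>x. f i x \<partial>Q)) F"
  shows "((\<lambda>a. dM f (P a) Q) \<longlongrightarrow> 0) F"
proof (cases "F = bot")
  case False
  let ?t = "\<lambda>i a. (1/2) ^ Suc i * min \<bar>(\<integral>x. f i x \<partial>P a) - (\<integral>x. f i x \<partial>Q)\<bar> (1::real)"
  have "((\<lambda>a. \<Sum>i. ?t i a) \<longlongrightarrow> (\<Sum>i::nat. 0)) F"
  proof (rule tannerys_theorem[THEN conjunct2, THEN conjunct2])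
    fix i
    have "((\<lambda>a. ?t i a) \<longlongrightarrow> (1/2) ^ Suc i * min \<bar>(\<integral>x. f i x \<partial>Q) - (\<integral>x. f i x \<partial>Q)\<bar> 1) F"
      by (intro tendsto_intros assms)
    then show "((\<lambda>a. ?t i a) \<longlongrightarrow> 0) F"
      by simp
  next
    show "\<forall>\<^sub>F (i, a) in sequentially \<times>\<^sub>F F. norm (?t i a) \<le> (1/2) ^ Suc i"
      by (intro always_eventually) (auto simp: abs_mult)
    show "summable (\<lambda>i. (1/2::real) ^ Suc i)"
      by (subst summable_Suc_iff) (auto intro: summable_geometric)
  qed (rule False)
  then show ?thesis
    by (simp add: dM_def)
qed simp

locale levy_prm =
  fixes M :: "'w measure"
    and N :: "'w \<Rightarrow> (real \<times> real \<times> 'x::topological_space) measure"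
    and rho :: "real measure"
    and H :: "'x measure"
  assumes rho_sets [measurable_cong]: "sets rho = sets borel"
    and rho_supp: "emeasure rho {..0} = 0"
    and rho_levy: "(\<integral>\<^sup>+ s. ennreal (min s 1) \<partial>rho) < \<infinity>"
    and rho_inf: "emeasure rho {0<..} = \<infinity>"
    and tau1: "(\<integral>\<^sup>+ s. ennreal s * indicator {1..} s \<partial>rho) < \<infinity>"
    and H_prob: "prob_space H"
    and H_sets [measurable_cong]: "sets H = sets borel"
    and N_prm: "poisson_random_measure M N (mean_measure rho H)"
begin

sublocale N: prm M N "mean_measure rho H"
  using N_prm by unfold_locales

sublocale H: prob_space H
  by (rule H_prob)

lemma space_rho [simp]: "space rho = UNIV" and space_H [simp]: "space H = UNIV"
  using sets_eq_imp_space_eq[OF rho_sets] sets_eq_imp_space_eq[OF H_sets] by simp_all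

lemma AE_rho_pos: "AE s in rho. 0 < s"
  by (rule AE_I[of _ _ "{..0}"]) (auto simp: rho_supp rho_sets not_less)

lemma integrable_jump_size: "integrable rho (\<lambda>s. s)"
proof (rule integrableI_bounded)
  have "(\<integral>\<^sup>+s. ennreal (norm s) \<partial>rho) \<le> (\<integral>\<^sup>+s. ennreal (min s 1) + ennreal s * indicator {1..} s \<partial>rho)"
    using AE_rho_pos by (intro nn_integral_mono_AE, eventually_elim)
      (auto split: split_indicator simp: min_def)
  also have "\<dots> = (\<integral>\<^sup>+s. ennreal (min s 1) \<partial>rho) + (\<integral>\<^sup>+s. ennreal s * indicator {1..} s \<partial>rho)"
    by (intro nn_integral_add) auto
  also have "\<dots> < \<infinity>"
    using rho_levy tau1 by simp
  finally show "(\<integral>\<^sup>+s. ennreal (norm s) \<partial>rho) < \<infinity>" .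
qed simp

definition jump_mean :: real where
  "jump_mean = (\<integral>s. s \<partial>rho)"

lemma jump_mean_pos: "0 < jump_mean"
proof -
  have "\<not> (AE s in rho. s = 0)"
  proof
    assume "AE s in rho. s = 0"
    then have "AE s in rho. s \<notin> {0<..}"
      by eventually_elim simp
    then have "emeasure rho {0<..} = 0"
      by (subst (asm) AE_iff_measurable[of "{0<..}"]) (auto simp: rho_sets)
    then show False
      using rho_inf by simp
  qed
  moreover have "AE s in rho. 0 \<le> s"
    using AE_rho_pos by eventually_elim simp
  ultimately show ?thesis
    unfolding jump_mean_def using integrable_jump_size integral_nonneg_eq_0_iff_AE[of rho "\<lambda>s. s"]
      integral_nonneg_AE[of "\<lambda>s. s" rho] by fastforce
qed

lemma sigma_finite_rho: "sigma_finite_measure rho"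
  using integrable_jump_size AE_rho_pos by (rule sigma_finite_measure_of_integrable_pos)

sublocale RH: pair_sigma_finite rho H
  by (simp add: pair_sigma_finite_def sigma_finite_rho H.sigma_finite_measure_axioms)

definition marked_jumps :: "real \<Rightarrow> 'w \<Rightarrow> (real \<times> 'x) measure" where
  "marked_jumps a w = distr (density (N w) (indicator ({0..a} \<times> UNIV))) (rho \<Otimes>\<^sub>M H) snd"

lemma sets_mean_measure [measurable_cong]:
  "sets (mean_measure rho H) = sets (borel \<Otimes>\<^sub>M (rho \<Otimes>\<^sub>M H))"
  unfolding mean_measure_def by (simp cong: sets_pair_measure_cong)

lemma UNIV_in_sets_H [measurable]: "UNIV \<in> sets H" and prob_UNIV_H [simp]: "H.prob UNIV = 1"
  using sets.top[of H] H.prob_space by simp_all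

lemma strip_in_sets_mean_measure: "{0..a} \<times> UNIV \<in> sets (mean_measure rho H)"
  using sets.top[of "rho \<Otimes>\<^sub>M H"] unfolding sets_mean_measure
  by (intro pair_measureI) (auto simp: space_pair_measure)

lemma strip_in_sets_N: "w \<in> space M \<Longrightarrow> {0..a} \<times> UNIV \<in> sets (N w)"
  using strip_in_sets_mean_measure by (simp add: N.sets_N)

lemma emeasure_rho_H_positive:
  assumes [measurable]: "B \<in> sets (rho \<Otimes>\<^sub>M H)"
  shows "emeasure (rho \<Otimes>\<^sub>M H) (({0<..} \<times> UNIV) \<inter> B) = emeasure (rho \<Otimes>\<^sub>M H) B"
proof (rule emeasure_eq_AE)
  have "{..0} \<times> UNIV \<in> null_sets (rho \<Otimes>\<^sub>M H)"
    using H.emeasure_pair_measure_Times[of "{..0}" rho UNIV]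
    by (auto simp: null_sets_def rho_supp rho_sets)
  then show "AE z in rho \<Otimes>\<^sub>M H. z \<in> ({0<..} \<times> UNIV) \<inter> B \<longleftrightarrow> z \<in> B"
    by (rule AE_I') auto
qed measurable

lemma distr_mean_measure_strip:
  assumes a_pos: "0 < a"
  shows "distr (density (mean_measure rho H) (indicator ({0..a} \<times> UNIV))) (rho \<Otimes>\<^sub>M H) snd
    = density (rho \<Otimes>\<^sub>M H) (\<lambda>_. ennreal a)" (is "?strip = _")
proof (rule measure_eqI)
  let ?L = "lborel \<Otimes>\<^sub>M (rho \<Otimes>\<^sub>M H)"
  fix B assume "B \<in> sets ?strip"
  then have B_sets [measurable]: "B \<in> sets (rho \<Otimes>\<^sub>M H)"
    by simp
  have [measurable]: "{0..a} \<times> B \<in> sets ?L"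
    using B_sets by (intro pair_measureI) auto
  have "emeasure ?strip B
      = emeasure (mean_measure rho H) (({0..a} \<times> UNIV) \<inter> (snd -` B \<inter> space (mean_measure rho H)))"
    by (intro emeasure_distr_restricted strip_in_sets_mean_measure) measurable
  also have "({0..a} \<times> UNIV) \<inter> (snd -` B \<inter> space (mean_measure rho H)) = {0..a} \<times> B"
    by (auto simp: mean_measure_def space_pair_measure)
  also have "emeasure (mean_measure rho H) ({0..a} \<times> B)
      = emeasure ?L (({0..} \<times> {0<..} \<times> UNIV) \<inter> {0..a} \<times> B)"
    unfolding mean_measure_def by (rule emeasure_restricted) measurable
  also have "({0..} \<times> {0<..} \<times> UNIV) \<inter> {0..a} \<times> B = {0..a} \<times> (({0<..} \<times> UNIV) \<inter> B)"
    by auto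
  also have "emeasure ?L \<dots> = ennreal a * emeasure (rho \<Otimes>\<^sub>M H) (({0<..} \<times> UNIV) \<inter> B)"
    using a_pos RH.P.emeasure_pair_measure_Times[of "{0..a}" lborel "({0<..} \<times> UNIV) \<inter> B"] by simp
  also have "\<dots> = emeasure (density (rho \<Otimes>\<^sub>M H) (\<lambda>_. ennreal a)) B"
    by (simp add: emeasure_rho_H_positive emeasure_density_const)
  finally show "emeasure ?strip B = emeasure (density (rho \<Otimes>\<^sub>M H) (\<lambda>_. ennreal a)) B" .
qed simp

sublocale homogeneous_prm M marked_jumps "rho \<Otimes>\<^sub>M H"
proof (rule homogeneous_prm.intro)
  show "prm M (marked_jumps a) (density (rho \<Otimes>\<^sub>M H) (\<lambda>_. ennreal a))" if "0 < a" for a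
    using N.prm_distr_restrict[OF strip_in_sets_mean_measure, of snd "rho \<Otimes>\<^sub>M H" a]
    by (simp add: distr_mean_measure_strip[OF that] marked_jumps_def[abs_def])
  show "marked_jumps a w \<le> marked_jumps c w" if w_in_space: "w \<in> space M" and "a \<le> c" for w a c
  proof -
    have snd_measurable: "snd \<in> measurable (N w) (rho \<Otimes>\<^sub>M H)"
      by (rule N.measurable_N[OF w_in_space]) measurable
    have "emeasure (marked_jumps a w) B \<le> emeasure (marked_jumps c w) B" if "B \<in> sets (rho \<Otimes>\<^sub>M H)" for B
      unfolding marked_jumps_def emeasure_distr_restricted[OF strip_in_sets_N[OF w_in_space] snd_measurable that]
      using \<open>a \<le> c\<close> measurable_sets[OF snd_measurable that] strip_in_sets_N[OF w_in_space]
      by (intro emeasure_mono) auto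
    then show ?thesis
      by (subst le_measure) (auto simp: marked_jumps_def)
  qed
qed

text \<open>Negative jump sizes form a null set for \<open>rho\<close>, but \<open>marked_jumps a w\<close> may charge them on an
  exceptional event; \<open>ennreal s\<close> in the definition of \<open>crm\<close> cuts them off, whence \<open>max 0\<close>.\<close>

lemma integral_rho_H_product:
  fixes f :: "'x \<Rightarrow> real"
  assumes f_integrable: "integrable H f"
  shows "integrable (rho \<Otimes>\<^sub>M H) (\<lambda>z. max 0 (fst z) * f (snd z))"
    and "(\<integral>z. max 0 (fst z) * f (snd z) \<partial>(rho \<Otimes>\<^sub>M H)) = jump_mean * (\<integral>x. f x \<partial>H)"
proof -
  note [measurable] = borel_measurable_integrable[OF f_integrable]
  have jump_size_integrable: "integrable rho (\<lambda>s. max 0 s)"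
    using integrable_jump_size by auto
  show product_integrable: "integrable (rho \<Otimes>\<^sub>M H) (\<lambda>z. max 0 (fst z) * f (snd z))"
    using f_integrable jump_size_integrable by (intro RH.Fubini_integrable) (auto simp: abs_mult)
  have "(\<integral>z. max 0 (fst z) * f (snd z) \<partial>(rho \<Otimes>\<^sub>M H)) = (\<integral>s. max 0 s * (\<integral>x. f x \<partial>H) \<partial>rho)"
    using f_integrable by (simp flip: RH.integral_fst'[OF product_integrable])
  also have "\<dots> = (\<integral>s. max 0 s \<partial>rho) * (\<integral>x. f x \<partial>H)"
    by simp
  also have "(\<integral>s. max 0 s \<partial>rho) = jump_mean"
    unfolding jump_mean_def using AE_rho_pos
    by (intro integral_cong_AE) auto
  finally show "(\<integral>z. max 0 (fst z) * f (snd z) \<partial>(rho \<Otimes>\<^sub>M H)) = jump_mean * (\<integral>x. f x \<partial>H)" .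
qed

lemma crm_eq_distr_marked_jumps:
  assumes w_in_space: "w \<in> space M"
  shows "crm N a w = distr (density (marked_jumps a w) (\<lambda>z. ennreal (fst z))) borel snd"
proof -
  note [measurable_cong] = N.sets_N[OF w_in_space]
  have "density (marked_jumps a w) (\<lambda>z. ennreal (fst z))
      = distr (density (density (N w) (indicator ({0..a} \<times> UNIV))) (\<lambda>z. ennreal (fst (snd z))))
          (rho \<Otimes>\<^sub>M H) snd"
    unfolding marked_jumps_def by (rule density_distr) measurable
  also have "density (density (N w) (indicator ({0..a} \<times> UNIV))) (\<lambda>z. ennreal (fst (snd z)))
      = density (N w) (\<lambda>z. ennreal (fst (snd z)) * indicator ({0..a} \<times> UNIV) z)"
    using strip_in_sets_N[OF w_in_space] by (subst density_density_eq) (auto simp: mult.commute)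
  finally show ?thesis
    by (simp add: crm_def distr_distr comp_def)
qed

lemma integral_crm:
  fixes f :: "'x \<Rightarrow> real"
  assumes w_in_space: "w \<in> space M" and f_measurable: "f \<in> borel_measurable borel"
  shows "(\<integral>x. f x \<partial>crm N a w) = (\<integral>z. max 0 (fst z) * f (snd z) \<partial>marked_jumps a w)"
proof -
  have [measurable_cong]: "sets (marked_jumps a w) = sets (rho \<Otimes>\<^sub>M H)"
    by (simp add: marked_jumps_def)
  note [measurable] = f_measurable
  have "(\<integral>x. f x \<partial>crm N a w)
      = (\<integral>z. f (snd z) \<partial>density (marked_jumps a w) (\<lambda>z. ennreal (max 0 (fst z))))"
    unfolding crm_eq_distr_marked_jumps[OF w_in_space] ennreal_max_0
    by (intro integral_distr) measurable
  also have "\<dots> = (\<integral>z. max 0 (fst z) * f (snd z) \<partial>marked_jumps a w)"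
    by (subst integral_density) auto
  finally show ?thesis .
qed

lemma sets_crm [simp]: "sets (crm N a w) = sets borel" and space_crm [simp]: "space (crm N a w) = UNIV"
  by (simp_all add: crm_def)

lemma borel_measurable_of_integrable_H:
  fixes f :: "'x \<Rightarrow> real"
  shows "integrable H f \<Longrightarrow> f \<in> borel_measurable borel"
  using borel_measurable_integrable measurable_cong_sets[OF H_sets refl] by blast

lemma crm_strong_law:
  fixes f :: "'x \<Rightarrow> real"
  assumes f_integrable: "integrable H f"
  shows "AE w in M. ((\<lambda>a. (\<integral>x. f x \<partial>crm N a w) / a) \<longlongrightarrow> jump_mean * (\<integral>x. f x \<partial>H)) at_top"
  using integral_K_strong_law[OF integral_rho_H_product(1)[OF f_integrable]] AE_space
  by (auto simp: integral_crm integral_rho_H_product(2)[OF f_integrable]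
      borel_measurable_of_integrable_H[OF f_integrable])

lemma crm_total_mass_strong_law:
  "AE w in M. ((\<lambda>a. measure (crm N a w) UNIV / a) \<longlongrightarrow> jump_mean) at_top"
  using crm_strong_law[of "\<lambda>_. 1"] by simp

lemma AE_crm_total_mass_pos: "AE w in M. \<forall>\<^sub>F a in at_top. 0 < measure (crm N a w) UNIV"
  using crm_total_mass_strong_law
proof eventually_elim
  case (elim w)
  show ?case
    using order_tendstoD(1)[OF elim jump_mean_pos] eventually_gt_at_top[of 0]
    by eventually_elim (simp add: zero_less_divide_iff)
qed

lemma AE_prob_space_hnrmi: "AE w in M. \<forall>\<^sub>F a in at_top. prob_space (hnrmi N a w)"
  using AE_crm_total_mass_pos
  unfolding hnrmi_def by eventually_elim
    (erule eventually_mono, rule prob_space_density_inverse_mass, simp)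

lemma hnrmi_strong_law:
  fixes f :: "'x \<Rightarrow> real"
  assumes f_integrable: "integrable H f"
  shows "AE w in M. ((\<lambda>a. \<integral>x. f x \<partial>hnrmi N a w) \<longlongrightarrow> (\<integral>x. f x \<partial>H)) at_top"
proof -
  have f_measurable_crm: "f \<in> borel_measurable (crm N a w)" for a w
    using borel_measurable_of_integrable_H[OF f_integrable] measurable_cong_sets[OF sets_crm refl]
    by blast
  show ?thesis
    using crm_strong_law[OF f_integrable] crm_total_mass_strong_law AE_crm_total_mass_pos
  proof eventually_elim
    case (elim w)
    have "((\<lambda>a. ((\<integral>x. f x \<partial>crm N a w) / a) / (measure (crm N a w) UNIV / a)) \<longlongrightarrow> (\<integral>x. f x \<partial>H)) at_top"
      using tendsto_divide[OF elim(1,2)] jump_mean_pos by simp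
    moreover have "\<forall>\<^sub>F a in at_top. ((\<integral>x. f x \<partial>crm N a w) / a) / (measure (crm N a w) UNIV / a)
        = (\<integral>x. f x \<partial>hnrmi N a w)"
      using elim(3) eventually_gt_at_top[of 0]
    proof eventually_elim
      case (elim a)
      then show ?case
        using integral_density_inverse_mass[OF _ f_measurable_crm, of a w] by (simp add: hnrmi_def)
    qed
    ultimately show ?case
      by (rule Lim_transform_eventually)
  qed
qed

lemma sets_hnrmi: "sets (hnrmi N a w) = sets H"
  by (simp add: hnrmi_def H_sets)

lemma hnrmi_measure_strong_law:
  assumes "A \<in> sets H"
  shows "AE w in M. ((\<lambda>a. measure (hnrmi N a w) A) \<longlongrightarrow> measure H A) at_top"
proof -
  have "integrable H (indicator A :: 'x \<Rightarrow> real)"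
    using assms by (simp add: H.emeasure_eq_measure)
  from hnrmi_strong_law[OF this] show ?thesis
    using assms by (simp add: sets_hnrmi)
qed

theorem hnrmi_dM_tendsto_0:
  fixes f :: "nat \<Rightarrow> 'x \<Rightarrow> real"
  assumes "\<And>i. integrable H (f i)"
  shows "AE w in M. ((\<lambda>a. dM f (hnrmi N a w) H) \<longlongrightarrow> 0) at_top"
proof -
  have "AE w in M. \<forall>i. ((\<lambda>a. \<integral>x. f i x \<partial>hnrmi N a w) \<longlongrightarrow> (\<integral>x. f i x \<partial>H)) at_top"
    unfolding AE_all_countable using assms by (intro allI hnrmi_strong_law)
  then show ?thesis
    by eventually_elim (intro dM_tendsto_0, blast)
qed

end

section \<open>Uniform convergence by bracketing\<close>

lemma abs_measure_diff_le_of_bracket: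
  assumes P_finite: "finite_measure P" "sets P = sets H" and H_finite: "finite_measure H"
    and events: "L \<in> sets H" "C \<in> sets H" "U \<in> sets H" and bracket: "L \<subseteq> C" "C \<subseteq> U"
    and gap: "measure H U - measure H L \<le> e"
    and deviations: "\<bar>measure P L - measure H L\<bar> \<le> d" "\<bar>measure P U - measure H U\<bar> \<le> d"
  shows "\<bar>measure P C - measure H C\<bar> \<le> d + e"
proof -
  have "measure m L \<le> measure m C" "measure m C \<le> measure m U"
    if "finite_measure m" "sets m = sets H" for m
    using that events bracket by (auto intro!: finite_measure.finite_measure_mono)
  from this[OF P_finite] this[OF H_finite refl] show ?thesis
    using gap deviations by linarith
qed

lemma SUP_abs_measure_diff_tendsto_0_of_bracketing:
  fixes P :: "'i \<Rightarrow> 'a measure" and C :: "'c \<Rightarrow> 'a set"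
  assumes P_finite: "\<forall>\<^sub>F a in F. finite_measure (P a) \<and> sets (P a) = sets H"
    and H_finite: "finite_measure H"
    and C_sets: "\<And>i. C i \<in> sets H"
    and brackets: "\<And>e. 0 < e \<Longrightarrow> \<exists>G. finite G \<and> G \<subseteq> sets H
      \<and> (\<forall>A\<in>G. ((\<lambda>a. measure (P a) A) \<longlongrightarrow> measure H A) F)
      \<and> (\<forall>i. \<exists>L\<in>G. \<exists>U\<in>G. L \<subseteq> C i \<and> C i \<subseteq> U \<and> measure H U - measure H L \<le> e)"
  shows "((\<lambda>a. SUP i. \<bar>measure (P a) (C i) - measure H (C i)\<bar>) \<longlongrightarrow> 0) F"
proof (rule tendstoI)
  fix e :: real assume e_pos: "0 < e"
  then obtain G where G_finite_sets: "finite G" "G \<subseteq> sets H"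
    and G_lim: "\<And>A. A \<in> G \<Longrightarrow> ((\<lambda>a. measure (P a) A) \<longlongrightarrow> measure H A) F"
    and bracket: "\<And>i. \<exists>L\<in>G. \<exists>U\<in>G. L \<subseteq> C i \<and> C i \<subseteq> U \<and> measure H U - measure H L \<le> e / 3"
    using brackets[of "e / 3"] by auto
  have "\<forall>\<^sub>F a in F. \<forall>A\<in>G. dist (measure (P a) A) (measure H A) < e / 3"
    using e_pos by (intro eventually_ball_finite G_finite_sets ballI tendstoD G_lim) auto
  then show "\<forall>\<^sub>F a in F. dist (SUP i. \<bar>measure (P a) (C i) - measure H (C i)\<bar>) 0 < e"
    using P_finite
  proof eventually_elim
    case (elim a)
    have deviation_le: "\<bar>measure (P a) (C i) - measure H (C i)\<bar> \<le> e / 3 + e / 3" for i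
    proof -
      obtain L U where "L \<in> G" "U \<in> G" "L \<subseteq> C i" "C i \<subseteq> U"
        "measure H U - measure H L \<le> e / 3"
        using bracket by blast
      then show ?thesis
        using elim G_finite_sets H_finite C_sets
        by (intro abs_measure_diff_le_of_bracket[of "P a" H L "C i" U])
          (auto simp: dist_real_def intro: less_imp_le)
    qed
    then have "(SUP i. \<bar>measure (P a) (C i) - measure H (C i)\<bar>) \<le> e / 3 + e / 3"
      by (intro cSUP_least) auto
    moreover have "0 \<le> (SUP i. \<bar>measure (P a) (C i) - measure H (C i)\<bar>)"
      using deviation_le
      by (intro cSUP_upper2[of _ _ undefined] bdd_aboveI2[where M = "e / 3 + e / 3"]) auto
    ultimately show ?case
      using e_pos by (simp add: dist_real_def)
  qed
qed

lemma (in real_distribution) nonatomic_quantile_exists: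
  assumes "\<And>x. prob {x} = 0" "0 < p" "p < 1"
  shows "\<exists>x. prob {..x} = p"
proof -
  have "\<forall>\<^sub>F x in at_bot. cdf M x < p"
    using cdf_lim_at_bot assms by (auto intro: order_tendstoD)
  then obtain l where below_l: "\<And>x. x \<le> l \<Longrightarrow> cdf M x < p"
    by (auto simp: eventually_at_bot_linorder)
  have "\<forall>\<^sub>F x in at_top. p < cdf M x"
    using cdf_lim_at_top_prob assms by (auto intro: order_tendstoD)
  then obtain u where above_u: "\<And>x. u \<le> x \<Longrightarrow> p < cdf M x"
    by (auto simp: eventually_at_top_linorder)
  have "l \<le> u"
    using below_l[of u] above_u[of u] by force
  then have "\<exists>x\<ge>l. x \<le> u \<and> cdf M x = p"
    using below_l[of l] above_u[of u] assms isCont_cdf by (intro IVT) (auto intro: less_imp_le)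
  then show ?thesis
    by (auto simp: cdf_def)
qed

lemma (in real_distribution) nonatomic_quantile_chain_exists:
  fixes n :: nat
  assumes nonatomic: "\<And>x. prob {x} = 0" and n_pos: "0 < n"
  shows "\<exists>Q. Q 0 = {} \<and> (\<forall>j\<ge>n. Q j = UNIV) \<and> range Q \<subseteq> events
    \<and> (\<forall>j. prob (Q j) = min (real j / n) 1) \<and> (\<forall>j y. Q j \<subseteq> {..y} \<or> {..y} \<subseteq> Q j)"
proof -
  define Q where "Q j = (if j = 0 then {} else if n \<le> j then UNIV
    else {..SOME x. prob {..x} = real j / n})" for j :: nat
  have "prob (Q j) = min (real j / n) 1" for j
  proof -
    consider (bottom) "j = 0" | (top) "n \<le> j" | (quantile) "0 < j" "j < n"
      by linarith
    then show ?thesis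
    proof cases
      case quantile
      then have "prob {..SOME x. prob {..x} = real j / n} = real j / n"
        using n_pos by (intro someI_ex[OF nonatomic_quantile_exists[OF nonatomic]]) auto
      then show ?thesis
        using quantile by (simp add: Q_def)
    qed (use n_pos prob_space in \<open>auto simp: Q_def\<close>)
  qed
  then show ?thesis
    using n_pos by (intro exI[of _ Q]) (auto simp: Q_def)
qed

lemma (in real_distribution) nonatomic_halfline_brackets:
  assumes nonatomic: "\<And>x. prob {x} = 0" and e_pos: "0 < e"
  shows "\<exists>G. finite G \<and> G \<subseteq> events
    \<and> (\<forall>y. \<exists>L\<in>G. \<exists>U\<in>G. L \<subseteq> {..y} \<and> {..y} \<subseteq> U \<and> prob U - prob L \<le> e)"
proof -
  obtain n0 where "1 / real (Suc n0) < e / 2"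
    using nat_approx_posE[of "e / 2"] e_pos by auto
  then obtain n :: nat where n_pos: "0 < n" and two_div_n_le: "2 / real n \<le> e"
    by (intro that[of "Suc n0"]) auto
  obtain Q where Q_0: "Q 0 = {}" and Q_top: "\<And>j. n \<le> j \<Longrightarrow> Q j = UNIV" and Q_events: "range Q \<subseteq> events"
    and prob_Q: "\<And>j. prob (Q j) = min (real j / n) 1" and nested: "\<And>j y. Q j \<subseteq> {..y} \<or> {..y} \<subseteq> Q j"
    using nonatomic_quantile_chain_exists[OF nonatomic n_pos] by metis
  have "\<exists>L\<in>Q ` {..Suc n}. \<exists>U\<in>Q ` {..Suc n}. L \<subseteq> {..y} \<and> {..y} \<subseteq> U \<and> prob U - prob L \<le> e" for y
  proof -
    define j where "j = nat \<lfloor>n * prob {..y}\<rfloor>"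
    have j_bounds: "j \<le> n * prob {..y}" "n * prob {..y} < j + 1"
      by (simp_all add: j_def) linarith
    have "n * prob {..y} \<le> n"
      by (simp add: mult_left_le)
    with j_bounds have "j \<le> n"
      by linarith
    have lower: "Q (j - 1) \<subseteq> {..y}"
    proof (cases "j = 0")
      case False
      then have "prob (Q (j - 1)) < prob {..y}"
        using j_bounds n_pos \<open>j \<le> n\<close> by (simp add: prob_Q field_simps of_nat_diff min_def)
      then show ?thesis
        using nested[of "j - 1" y] finite_measure_mono[of "{..y}" "Q (j - 1)"] Q_events by force
    qed (simp add: Q_0)
    have upper: "{..y} \<subseteq> Q (j + 1)"
    proof (cases "n \<le> j + 1")
      case False
      then have "prob {..y} < prob (Q (j + 1))"
        using j_bounds n_pos by (simp add: prob_Q field_simps min_def)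
      then show ?thesis
        using nested[of "j + 1" y] finite_measure_mono[of "Q (j + 1)" "{..y}"] Q_events by force
    qed (simp add: Q_top)
    have "prob (Q (j + 1)) - prob (Q (j - 1)) \<le> real (j + 1) / n - real (j - 1) / n"
      using \<open>j \<le> n\<close> n_pos unfolding prob_Q by (simp add: min_def)
    also have "\<dots> \<le> 2 / n"
      unfolding diff_divide_distrib[symmetric] by (intro divide_right_mono) (cases j; simp)+
    finally show ?thesis
      using lower upper two_div_n_le \<open>j \<le> n\<close>
      by (intro bexI[of _ "Q (j - 1)"] bexI[of _ "Q (j + 1)"]) auto
  qed
  then show ?thesis
    using Q_events by (intro exI[of _ "Q ` {..Suc n}"]) auto
qed

theorem hnrmi_Glivenko_Cantelli:
  fixes M :: "'w measure" and N :: "'w \<Rightarrow> (real \<times> real \<times> real) measure" and H :: "real measure"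
  assumes "levy_prm M N rho H" and nonatomic: "\<And>x. emeasure H {x} = 0"
  shows "AE w in M. ((\<lambda>a. SUP x. \<bar>measure (hnrmi N a w) {..x} - measure H {..x}\<bar>) \<longlongrightarrow> 0) at_top"
proof -
  interpret levy_prm M N rho H by fact
  interpret H: real_distribution H
    by unfold_locales (simp_all add: H_sets)
  have "\<exists>G. finite G \<and> G \<subseteq> sets H \<and>
      (\<forall>y. \<exists>L\<in>G. \<exists>U\<in>G. L \<subseteq> {..y} \<and> {..y} \<subseteq> U \<and> measure H U - measure H L \<le> 1 / real (Suc n))" for n
    using nonatomic by (intro H.nonatomic_halfline_brackets) (simp_all add: measure_def)
  then obtain G where G_finite_sets: "finite (G n)" "G n \<subseteq> sets H"
    and brackets: "\<exists>L\<in>G n. \<exists>U\<in>G n. L \<subseteq> {..y} \<and> {..y} \<subseteq> U \<and> measure H U - measure H L \<le> 1 / real (Suc n)"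
    for n y by metis
  have "AE w in M. \<forall>n. \<forall>A\<in>G n. ((\<lambda>a. measure (hnrmi N a w) A) \<longlongrightarrow> measure H A) at_top"
    using G_finite_sets unfolding AE_all_countable
    by (intro allI AE_finite_allI hnrmi_measure_strong_law) auto
  then show ?thesis
    using AE_prob_space_hnrmi
  proof eventually_elim
    case (elim w)
    show ?case
    proof (rule SUP_abs_measure_diff_tendsto_0_of_bracketing)
      show "\<forall>\<^sub>F a in at_top. finite_measure (hnrmi N a w) \<and> sets (hnrmi N a w) = sets H"
        using elim(2) by eventually_elim (simp add: prob_space.finite_measure sets_hnrmi)
      fix e :: real assume "0 < e"
      then obtain n where "1 / real (Suc n) < e"
        by (rule nat_approx_posE)
      then show "\<exists>G. finite G \<and> G \<subseteq> sets H \<and>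
          (\<forall>A\<in>G. ((\<lambda>a. measure (hnrmi N a w) A) \<longlongrightarrow> measure H A) at_top)
          \<and> (\<forall>y. \<exists>L\<in>G. \<exists>U\<in>G. L \<subseteq> {..y} \<and> {..y} \<subseteq> U \<and> measure H U - measure H L \<le> e)"
        using G_finite_sets elim(1) brackets[of n]
        by (intro exI[of _ "G n"]) (meson less_imp_le order_trans)
    qed (simp_all add: H_sets H.finite_measure_axioms)
  qed
qed

theorem theorem1:
  fixes M :: "'w measure"
    and N :: "'w \<Rightarrow> (real \<times> real \<times> 'x::polish_space) measure"
    and rho :: "real measure"
    and H :: "'x measure"
    and f :: "nat \<Rightarrow> 'x \<Rightarrow> real"
  assumes rho_sets: "sets rho = sets borel"
    and rho_supp: "emeasure rho {..0} = 0"
    and rho_levy: "(\<integral>\<^sup>+ s. ennreal (min s 1) \<partial>rho) < \<infinity>"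
    and rho_inf: "emeasure rho {0<..} = \<infinity>"
    and tau1: "(\<integral>\<^sup>+ s. ennreal s * indicator {1..} s \<partial>rho) < \<infinity>"
    and H_prob: "prob_space H"
    and H_sets: "sets H = sets borel"
    and H_nonatomic: "\<And>x. emeasure H {x} = 0"
    and N_prm: "poisson_random_measure M N (mean_measure rho H)"
    and f_cont: "\<And>i. continuous_on UNIV (f i)"
    and f_bdd: "\<And>i. bounded (range (f i))"
  shows "(AE w in M. ((\<lambda>a. dM f (hnrmi N a w) H) \<longlongrightarrow> 0) at_top)
       \<and> (\<forall>(M' :: 'v measure) (N' :: 'v \<Rightarrow> (real \<times> real \<times> real) measure) (H' :: real measure).
            prob_space H' \<and> sets H' = sets borel \<and> (\<forall>x. emeasure H' {x} = 0) \<and>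
            poisson_random_measure M' N' (mean_measure rho H') \<longrightarrow>
            (AE w in M'. ((\<lambda>a. SUP x. \<bar>measure (hnrmi N' a w) {..x} - measure H' {..x}\<bar>)
                \<longlongrightarrow> 0) at_top))"
proof (intro conjI allI impI)
  interpret levy_prm M N rho H
    using assms by (intro levy_prm.intro)
  have "integrable H (f i)" for i
    using H.finite_measure_axioms H_sets f_cont f_bdd by (rule integrable_bounded_continuous)
  then show "AE w in M. ((\<lambda>a. dM f (hnrmi N a w) H) \<longlongrightarrow> 0) at_top"
    by (rule hnrmi_dM_tendsto_0)
next
  fix M' :: "'v measure" and N' :: "'v \<Rightarrow> (real \<times> real \<times> real) measure" and H' :: "real measure"
  assume H': "prob_space H' \<and> sets H' = sets borel \<and> (\<forall>x. emeasure H' {x} = 0) \<and>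
    poisson_random_measure M' N' (mean_measure rho H')"
  then have "levy_prm M' N' rho H'"
    using rho_sets rho_supp rho_levy rho_inf tau1 by (auto intro: levy_prm.intro)
  then show "AE w in M'. ((\<lambda>a. SUP x. \<bar>measure (hnrmi N' a w) {..x} - measure H' {..x}\<bar>) \<longlongrightarrow> 0) at_top"
    using H' by (intro hnrmi_Glivenko_Cantelli) auto
qed

end
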